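(* For all $n,s\ge1$, the edge labeling $\lambda$ of $\Pi_{n,s+1}$ is an EL-labeling: for every interval $[x,y]$ of $\Pi_{n,s+1}$ there is a unique increasing maximal chain of $[x,y]$, and its label sequence lexicographically precedes the label sequences of all other maximal chains of $[x,y]$.
   Context: A vector partition of $[n]$ into $s+1$ components is a tuple $(P,w^1,\ldots,w^s)$ where $P$ is a set partition of $[n]$ and each $w^i$ assigns to every part $B$ of $P$ a label $w^i(B)\subseteq[n]$ (its $i$-th label) with $|w^i(B)|=|B|$, such that the $i$-th labels of all parts form a partition of $[n]$. $\Pi_{n,s+1}$ is the set of these tuples together with an added least element $\hat0$, ordered by $(P,w)\le(P',w')$ iff every part $B'$ of $P'$ is a union of parts of $P$ and, for each $i$, $w^{i\prime}(B')$ is the union of $w^i(B)$ over the parts $B\subseteq B'$ of $P$. Atoms: the elements whose partition is $\{1\},\ldots,\{n\}$; such an atom with $w^i(\{k\})=\{w^i_k\}$ is identified with the word $w^1_1\cdots w^1_n\cdots w^s_1\cdots w^s_n\in[n]^{ns}$, and atoms are ordered lexicographically by these words. For $x\ne\hat0$, $A(x)$ is the lexicographically least atom below $x$; explicitly, if $\{k_1<\cdots<k_p\}$ is a part of $x$ with $i$-th label $\{j_1<\cdots<j_p\}$, then $A(x)$ has $w^i_{k_a}=j_a$. Write $w^i_k(x)$ for the entry $w^i_k$ of $A(x)$. The edge labeling $\lambda$ maps covering relations to $\mathbb Z^3$ ordered lexicographically: - if $x\lessdot y$, $x\ne\hat0$, $A(x)\ne A(y)$: $\lambda(x\lessdot y)=(k,i,j)$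 where $(k,i)$ is the lexicographically least pair (first by $k$, then by $i$) with $w^i_k(x)\ne w^i_k(y)$, and $j=w^i_k(y)$; - if $x\lessdot y$, $x\ne\hat0$, $A(x)=A(y)$: $\lambda(x\lessdot y)=(n,\max(I\cup J),0)$ where $I,J$ are the parts of the partition of $x$ merged to form the partition of $y$; - $\lambda(\hat0\lessdot a)=(n-1,s+m,0)$ where $a$ is the $m$-th atom in lexicographic order. A maximal chain $x_0\lessdot\cdots\lessdot x_m$ of an interval is increasing if its label sequence $\lambda(x_0\lessdot x_1),\ldots,\lambda(x_{m-1}\lessdot x_m)$ is strictly increasing; label sequences are compared lexicographically. *)

theory Defs
  imports "HOL-Library.Disjoint_Sets" "HOL-Library.FuncSet"
    "HOL-Library.Product_Lexorder" "HOL-Library.List_Lexorder"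
begin

section \<open>EL-labelings\<close>

definition covers :: "'a set \<Rightarrow> ('a \<Rightarrow> 'a \<Rightarrow> bool) \<Rightarrow> 'a \<Rightarrow> 'a \<Rightarrow> bool" where
  "covers A le x y \<longleftrightarrow> x \<in> A \<and> y \<in> A \<and> le x y \<and> x \<noteq> y \<and>
     (\<forall>z\<in>A. le x z \<and> le z y \<longrightarrow> z = x \<or> z = y)"

definition maximal_chains :: "'a set \<Rightarrow> ('a \<Rightarrow> 'a \<Rightarrow> bool) \<Rightarrow> 'a \<Rightarrow> 'a \<Rightarrow> 'a list set" where
  "maximal_chains A le x y =
     {c. c \<noteq> [] \<and> set c \<subseteq> A \<and> hd c = x \<and> last c = y \<and>
         (\<forall>r. Suc r < length c \<longrightarrow> covers A le (c ! r) (c ! Suc r))}"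

definition label_seq :: "('a \<Rightarrow> 'a \<Rightarrow> 'b) \<Rightarrow> 'a list \<Rightarrow> 'b list" where
  "label_seq lam c = map (\<lambda>r. lam (c ! r) (c ! Suc r)) [0..<length c - 1]"

definition increasing_chain :: "('a \<Rightarrow> 'a \<Rightarrow> 'b::linorder) \<Rightarrow> 'a list \<Rightarrow> bool" where
  "increasing_chain lam c \<longleftrightarrow> sorted_wrt (<) (label_seq lam c)"

text \<open>Lists of labels are compared by the lexicographic order of
  \<^theory>\<open>HOL-Library.List_Lexorder\<close>.\<close>

definition EL_labeling ::
    "'a set \<Rightarrow> ('a \<Rightarrow> 'a \<Rightarrow> bool) \<Rightarrow> ('a \<Rightarrow> 'a \<Rightarrow> 'b::linorder) \<Rightarrow> bool" where
  "EL_labeling A le lam \<longleftrightarrow>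
     (\<forall>x\<in>A. \<forall>y\<in>A. le x y \<longrightarrow>
        (\<exists>c\<in>maximal_chains A le x y.
           increasing_chain lam c \<and>
           (\<forall>d\<in>maximal_chains A le x y. increasing_chain lam d \<longrightarrow> d = c) \<and>
           (\<forall>d\<in>maximal_chains A le x y. d \<noteq> c \<longrightarrow> label_seq lam c < label_seq lam d)))"

section \<open>Vector partitions\<close>

text \<open>\<open>VP P w\<close> is the tuple \<open>(P, w 1, \<dots>, w s)\<close>; \<open>Bot\<close> is the added least element.\<close>

datatype vpart = Bot | VP (parts: "nat set set") (plabel: "nat \<Rightarrow> nat set \<Rightarrow> nat set")

text \<open>The label functions are extensional, so that distinct HOL values are distinct
  vector partitions.\<close>

definition vector_partitions :: "nat \<Rightarrow> nat \<Rightarrow> vpart set" where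
  "vector_partitions n s =
     insert Bot
       {VP P w | P w.
          partition_on {1..n} P \<and>
          w \<in> (\<Pi>\<^sub>E i\<in>{1..s}. \<Pi>\<^sub>E B\<in>P. {C. C \<subseteq> {1..n} \<and> card C = card B}) \<and>
          (\<forall>i\<in>{1..s}. inj_on (w i) P \<and> partition_on {1..n} (w i ` P))}"

fun vp_le :: "nat \<Rightarrow> vpart \<Rightarrow> vpart \<Rightarrow> bool" where
  "vp_le s Bot y \<longleftrightarrow> True"
| "vp_le s (VP P w) Bot \<longleftrightarrow> False"
| "vp_le s (VP P w) (VP P' w') \<longleftrightarrow>
     (\<forall>B'\<in>P'. (\<exists>S\<subseteq>P. B' = \<Union>S) \<and>
        (\<forall>i\<in>{1..s}. w' i B' = \<Union>{w i B | B. B \<in> P \<and> B \<subseteq> B'}))"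

definition atoms :: "nat \<Rightarrow> nat \<Rightarrow> vpart set" where
  "atoms n s = {a \<in> vector_partitions n s. a \<noteq> Bot \<and> parts a = (\<lambda>k. {k}) ` {1..n}}"

definition atom_entry :: "vpart \<Rightarrow> nat \<Rightarrow> nat \<Rightarrow> nat" where
  "atom_entry a i k = the_elem (plabel a i {k})"

definition atom_word :: "nat \<Rightarrow> nat \<Rightarrow> vpart \<Rightarrow> nat list" where
  "atom_word n s a = concat (map (\<lambda>i. map (atom_entry a i) [1..<Suc n]) [1..<Suc s])"

definition least_atom :: "nat \<Rightarrow> nat \<Rightarrow> vpart \<Rightarrow> vpart" where
  "least_atom n s x = arg_min_on (atom_word n s) {a \<in> atoms n s. vp_le s a x}"

definition entry :: "nat \<Rightarrow> nat \<Rightarrow> vpart \<Rightarrow> nat \<Rightarrow> nat \<Rightarrow> nat" where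
  "entry n s x i k = atom_entry (least_atom n s x) i k"

definition atom_rank :: "nat \<Rightarrow> nat \<Rightarrow> vpart \<Rightarrow> nat" where
  "atom_rank n s a = card {b \<in> atoms n s. atom_word n s b \<le> atom_word n s a}"

definition first_change :: "nat \<Rightarrow> nat \<Rightarrow> vpart \<Rightarrow> vpart \<Rightarrow> nat \<times> nat" where
  "first_change n s x y =
     (LEAST p. case p of (k, i) \<Rightarrow>
        k \<in> {1..n} \<and> i \<in> {1..s} \<and> entry n s x i k \<noteq> entry n s y i k)"

text \<open>For a covering relation above \<open>Bot\<close>, the union \<open>I \<union> J\<close> of the two merged parts.\<close>

definition merged_part :: "vpart \<Rightarrow> vpart \<Rightarrow> nat set" where
  "merged_part x y =
     (THE M. \<exists>I J. I \<in> parts x \<and> J \<in> parts x \<and> I \<noteq> J \<and> M = I \<union> J \<and>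
        parts y = insert M (parts x - {I, J}))"

text \<open>Triples carry the lexicographic order of \<^theory>\<open>HOL-Library.Product_Lexorder\<close>.
  Only the values on covering relations matter.\<close>

definition edge_label :: "nat \<Rightarrow> nat \<Rightarrow> vpart \<Rightarrow> vpart \<Rightarrow> int \<times> int \<times> int" where
  "edge_label n s x y =
     (if x = Bot then (int n - 1, int s + int (atom_rank n s y), 0)
      else if least_atom n s x \<noteq> least_atom n s y then
        (let (k, i) = first_change n s x y in (int k, int i, int (entry n s y i k)))
      else (int n, int (Max (merged_part x y)), 0))"

end

theory Submission
  imports Defs "HOL-Library.Infinite_Set"
begin

text \<open>
  It suffices to find, for every \<open>x < y\<close>, a cover \<open>z\<close> of \<open>x\<close> below \<open>y\<close> whose label is strictly smallest
  among the covers of \<open>x\<close> below \<open>y\<close>, is exceeded by every label directly above \<open>z\<close>, and is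
  unavoidable in the sense that after any other cover \<open>z'\<close> one can continue with a label not
  exceeding that of \<open>x \<lessdot> z'\<close>.

  If \<open>A(x) \<noteq> A(y)\<close> and \<open>(k, i)\<close> is the first place where they differ, then the entries up to \<open>(k, i)\<close>
  can only decrease along a chain, so every label is at least \<open>(k, i, w\<^sup>i\<^sub>k(y))\<close>, with equality
  exactly for the cover merging the part containing \<open>k\<close> with the part whose \<open>i\<close>-th label contains
  \<open>w\<^sup>i\<^sub>k(y)\<close>. If \<open>A(x) = A(y)\<close>, the label of a merge of \<open>I\<close> and \<open>J\<close> with \<open>max I < max J\<close> is given by
  \<open>max J\<close>, and one takes the admissible pair with \<open>max J\<close> minimal. From the least element one goes
  to \<open>A(y)\<close>: passing through another atom forces a later change of \<open>A\<close>, whose label starts with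
  some \<open>k < n\<close>.
\<close>

section \<open>A local criterion for EL-labelings\<close>

lemma label_seq_Cons: "label_seq lam (x # z # c) = lam x z # label_seq lam (z # c)"
proof -
  have "[0..<Suc (length c)] = 0 # map Suc [0..<length c]"
    by (simp add: map_Suc_upt upt_conv_Cons del: upt_Suc)
  then show ?thesis by (simp add: label_seq_def o_def del: upt_Suc)
qed

lemma label_seq_singleton: "label_seq lam [x] = []"
  by (simp add: label_seq_def)

lemma increasing_chain_Cons_Cons:
  "increasing_chain lam (x # z # v # c) \<longleftrightarrow>
    lam x z < lam z v \<and> increasing_chain lam (z # v # c)"
  by (auto simp: increasing_chain_def label_seq_Cons)

lemma increasing_chain_pair: "increasing_chain lam [x, z]"
  by (simp add: increasing_chain_def label_seq_Cons label_seq_singleton)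

section \<open>Maximal chains of a finite partial order\<close>

locale finite_order =
  fixes A :: "'a set" and le :: "'a \<Rightarrow> 'a \<Rightarrow> bool"
  assumes finite_carrier: "finite A"
    and le_refl: "x \<in> A \<Longrightarrow> le x x"
    and le_antisym: "\<lbrakk>x \<in> A; y \<in> A; le x y; le y x\<rbrakk> \<Longrightarrow> x = y"
    and le_trans: "\<lbrakk>x \<in> A; y \<in> A; z \<in> A; le x y; le y z\<rbrakk> \<Longrightarrow> le x z"
begin

lemma coversD:
  assumes "covers A le x y"
  shows "x \<in> A" "y \<in> A" "le x y" "x \<noteq> y"
  using assms by (auto simp: covers_def)

lemma maximal_chains_Cons_iff:
  "x # z # c \<in> maximal_chains A le x' y \<longleftrightarrow>
    x' = x \<and> covers A le x z \<and> z # c \<in> maximal_chains A le z y" (is "?L \<longleftrightarrow> ?R")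
proof
  assume L: ?L
  then have cov: "covers A le ((x # z # c) ! r) ((x # z # c) ! Suc r)"
    if "Suc r < length (x # z # c)" for r
    using that unfolding maximal_chains_def by blast
  have "covers A le x z" using cov[of 0] by simp
  moreover have "covers A le ((z # c) ! r) ((z # c) ! Suc r)" if "Suc r < length (z # c)" for r
    using cov[of "Suc r"] that by simp
  ultimately show ?R using L by (simp add: maximal_chains_def)
next
  assume R: ?R
  have "covers A le ((x # z # c) ! r) ((x # z # c) ! Suc r)"
    if "Suc r < length (x # z # c)" for r
    using R that by (cases r) (auto simp: maximal_chains_def)
  then show ?L using R by (auto simp: maximal_chains_def covers_def)
qed

lemma maximal_chains_singleton_iff:
  "[x] \<in> maximal_chains A le x' y \<longleftrightarrow> x \<in> A \<and> x' = x \<and> y = x"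
  by (auto simp: maximal_chains_def)

lemma maximal_chains_le: "c \<in> maximal_chains A le x y \<Longrightarrow> le x y \<and> x \<in> A \<and> y \<in> A"
proof (induction c arbitrary: x)
  case Nil
  then show ?case by (simp add: maximal_chains_def)
next
  case (Cons u c)
  show ?case
  proof (cases c)
    case Nil
    then show ?thesis using Cons.prems by (auto simp: maximal_chains_singleton_iff le_refl)
  next
    case (Cons z d)
    then have "x = u" "covers A le u z" "c \<in> maximal_chains A le z y"
      using Cons.prems by (auto simp: maximal_chains_Cons_iff)
    then show ?thesis using Cons.IH coversD[of u z] le_trans by blast
  qed
qed

lemma maximal_chains_refl: "x \<in> A \<Longrightarrow> maximal_chains A le x x = {[x]}"
proof (intro set_eqI iffI)
  fix c assume x: "x \<in> A" and c: "c \<in> maximal_chains A le x x"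
  show "c \<in> {[x]}"
  proof (cases c)
    case Nil
    then show ?thesis using c by (simp add: maximal_chains_def)
  next
    case u: (Cons u d)
    show ?thesis
    proof (cases d)
      case Nil
      then show ?thesis using c u by (simp add: maximal_chains_singleton_iff)
    next
      case (Cons z e)
      then have "covers A le x z" "le z x"
        using c u maximal_chains_le by (auto simp: maximal_chains_Cons_iff)
      then show ?thesis using coversD le_antisym by blast
    qed
  qed
qed (auto simp: maximal_chains_singleton_iff)

lemma maximal_chains_cases:
  assumes "c \<in> maximal_chains A le x y" "x \<noteq> y"
  obtains z d where "c = x # z # d" "covers A le x z" "z # d \<in> maximal_chains A le z y" "le z y"
proof (cases c)
  case Nil
  then show ?thesis using assms by (simp add: maximal_chains_def)
next
  case u: (Cons u d)
  show ?thesis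
  proof (cases d)
    case Nil
    then show ?thesis using assms u by (simp add: maximal_chains_singleton_iff)
  next
    case (Cons z e)
    then show ?thesis
      using assms u that maximal_chains_le by (auto simp: maximal_chains_Cons_iff)
  qed
qed

text \<open>The last inequality is weak on purpose: labels of an increasing chain grow strictly, so
  an equal label after \<open>z'\<close> already breaks it, and equality does occur when two
  successive merges produce the same maximum.\<close>

definition greedy_step :: "('a \<Rightarrow> 'a \<Rightarrow> 'b::linorder) \<Rightarrow> 'a \<Rightarrow> 'a \<Rightarrow> 'a \<Rightarrow> bool" where
  "greedy_step lam x y z \<longleftrightarrow> covers A le x z \<and> le z y \<and>
     (\<forall>v. covers A le z v \<and> le v y \<longrightarrow> lam x z < lam z v) \<and>
     (\<forall>z'. covers A le x z' \<and> le z' y \<and> z' \<noteq> z \<longrightarrow>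
        lam x z < lam x z' \<and> (\<exists>v. covers A le z' v \<and> le v y \<and> lam z' v \<le> lam x z'))"

text \<open>Induction on the size of the interval [x, y]: the increasing chain of [z, y] is
  prolonged by \<open>x\<close>. An increasing chain through another cover \<open>z'\<close> would
  have to continue with the increasing chain of [z', y]. That one is lexicographically first there,
  so it starts with a label at most \<open>lam z' v\<close>, hence at most
  \<open>lam x z'\<close>.\<close>

lemma EL_labeling_if_greedy_step:
  fixes lam :: "'a \<Rightarrow> 'a \<Rightarrow> 'b::linorder"
  assumes greedy: "\<And>x y. \<lbrakk>x \<in> A; y \<in> A; le x y; x \<noteq> y\<rbrakk> \<Longrightarrow> \<exists>z. greedy_step lam x y z"
  shows "EL_labeling A le lam"
proof -
  have "\<exists>c\<in>maximal_chains A le x y. increasing_chain lam c \<and>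
      (\<forall>d\<in>maximal_chains A le x y. increasing_chain lam d \<longrightarrow> d = c) \<and>
      (\<forall>d\<in>maximal_chains A le x y. d \<noteq> c \<longrightarrow> label_seq lam c < label_seq lam d)"
    if "x \<in> A" "y \<in> A" "le x y" for x y
    using that
  proof (induction "card {u \<in> A. le x u \<and> le u y}" arbitrary: x rule: less_induct)
    case less
    show ?case
    proof (cases "x = y")
      case True
      then show ?thesis using less.prems
        by (simp add: maximal_chains_refl increasing_chain_def label_seq_singleton)
    next
      case False
      obtain z where z: "greedy_step lam x y z" using greedy less.prems False by blast
      have IH: "\<exists>c\<in>maximal_chains A le v y. increasing_chain lam c \<and>
        (\<forall>d\<in>maximal_chains A le v y. increasing_chain lam d \<longrightarrow> d = c) \<and>
        (\<forall>d\<in>maximal_chains A le v y. d \<noteq> c \<longrightarrow> label_seq lam c < label_seq lam d)"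
        if v: "v \<in> A" "le x v" "x \<noteq> v" "le v y" for v
      proof (rule less.hyps)
        have "{u \<in> A. le v u \<and> le u y} \<subset> {u \<in> A. le x u \<and> le u y}"
          using v less.prems le_trans le_antisym le_refl by blast
        then show "card {u \<in> A. le v u \<and> le u y} < card {u \<in> A. le x u \<and> le u y}"
          by (intro psubset_card_mono) (auto simp: finite_carrier)
      qed (use v less.prems in auto)
      have xz: "covers A le x z" "le z y" using z by (auto simp: greedy_step_def)
      then obtain c where c: "c \<in> maximal_chains A le z y" "increasing_chain lam c"
        and c_unique: "\<And>d. d \<in> maximal_chains A le z y \<Longrightarrow> increasing_chain lam d \<Longrightarrow> d = c"
        and c_least: "\<And>d. d \<in> maximal_chains A le z y \<Longrightarrow> d \<noteq> c \<Longrightarrow> label_seq lam c < label_seq lam d"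
        using IH coversD[OF xz(1)] by blast
      obtain c' where c': "c = z # c'"
        using c(1) by (cases c) (auto simp: maximal_chains_def)
      have chain: "x # c \<in> maximal_chains A le x y"
        using c c' xz by (simp add: maximal_chains_Cons_iff)
      have inc: "increasing_chain lam (x # c)"
      proof (cases "z = y")
        case True
        then have "c = [z]" using c maximal_chains_refl coversD[OF xz(1)] by auto
        then show ?thesis by (simp add: increasing_chain_pair)
      next
        case False
        then obtain v d where "c = z # v # d" "covers A le z v" "le v y"
          using maximal_chains_cases[OF c(1)] by metis
        then show ?thesis using c z by (auto simp: greedy_step_def increasing_chain_Cons_Cons)
      qed
      have "d = x # c" if d: "d \<in> maximal_chains A le x y" "increasing_chain lam d" for d
      proof -
        obtain z' e where e: "d = x # z' # e" "covers A le x z'"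
          "z' # e \<in> maximal_chains A le z' y" "le z' y"
          using maximal_chains_cases[OF d(1) False] by metis
        have inc_e: "increasing_chain lam (z' # e)"
          using d(2) e(1) by (simp add: increasing_chain_def label_seq_Cons)
        show ?thesis
        proof (cases "z' = z")
          case True
          then show ?thesis using e inc_e c_unique by auto
        next
          case False
          then obtain v where v: "covers A le z' v" "le v y" "lam z' v \<le> lam x z'"
            using z e by (auto simp: greedy_step_def)
          \<comment> \<open>A cover of \<open>z'\<close> lies below \<open>y\<close>, so the chain
            from \<open>z'\<close> to \<open>y\<close> has a second element
            \<open>v'\<close>.\<close>
          have "z' \<noteq> y" using v coversD[OF v(1)] le_antisym by blast
          then obtain v' e' where e': "e = v' # e'"
            using maximal_chains_cases[OF e(3)] by (metis list.inject)
          obtain f where f: "f \<in> maximal_chains A le z' y" "increasing_chain lam f"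
            and f_unique: "\<And>d. d \<in> maximal_chains A le z' y \<Longrightarrow> increasing_chain lam d \<Longrightarrow> d = f"
            and f_least: "\<And>d. d \<in> maximal_chains A le z' y \<Longrightarrow> d \<noteq> f \<Longrightarrow> label_seq lam f < label_seq lam d"
            using IH e(4) coversD[OF e(2)] by blast
          have f_eq: "f = z' # v' # e'" using f_unique e e' inc_e by auto
          have "le x v" "x \<noteq> v"
            using coversD[OF v(1)] coversD[OF e(2)] le_trans[of x z' v] le_antisym[of x z'] by auto
          \<comment> \<open>Any maximal chain of [v, y] serves: it only exhibits a maximal chain of
            [z', y] beginning with the step to \<open>v\<close>, to be compared with
            \<open>f\<close>.\<close>
          then obtain h where h: "h \<in> maximal_chains A le v y"
            using IH[of v] v coversD[OF v(1)] by blast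
          then obtain g where g: "v # g \<in> maximal_chains A le v y"
            by (cases h) (auto simp: maximal_chains_def)
          have "lam z' v' \<le> lam z' v"
          proof -
            have "z' # v # g \<in> maximal_chains A le z' y" using g v by (simp add: maximal_chains_Cons_iff)
            then have "z' # v # g = f \<or> label_seq lam f < label_seq lam (z' # v # g)"
              using f_least by blast
            then show ?thesis using f_eq by (auto simp: label_seq_Cons)
          qed
          moreover have "lam x z' < lam z' v'"
            using d(2) e(1) e' by (simp add: increasing_chain_Cons_Cons)
          ultimately show ?thesis using v(3) by simp
        qed
      qed
      moreover have "label_seq lam (x # c) < label_seq lam d"
        if d: "d \<in> maximal_chains A le x y" "d \<noteq> x # c" for d
      proof -
        obtain z' e where e: "d = x # z' # e" "covers A le x z'"
          "z' # e \<in> maximal_chains A le z' y" "le z' y"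
          using maximal_chains_cases[OF d(1) False] by metis
        show ?thesis
        proof (cases "z' = z")
          case True
          then show ?thesis using e c_least[of "z' # e"] c' d(2) by (auto simp: label_seq_Cons)
        next
          case False
          then have "lam x z < lam x z'" using z e by (auto simp: greedy_step_def)
          then show ?thesis using c' e(1) by (auto simp: label_seq_Cons)
        qed
      qed
      ultimately show ?thesis using chain inc by blast
    qed
  qed
  then show ?thesis unfolding EL_labeling_def by blast
qed

end

section \<open>Lexicographic comparison and increasing bijections\<close>

text \<open>Since \<open>ps\<close> is strictly sorted, the elements listed before \<open>p\<close>
  are those smaller than \<open>p\<close>, so \<open>p\<close> marks the first position where the
  two lists differ.\<close>

lemma map_less_map:
  fixes f g :: "'a::linorder \<Rightarrow> 'b::linorder"
  assumes "sorted_wrt (<) ps" "p \<in> set ps" "f p < g p" "\<And>q. q \<in> set ps \<Longrightarrow> q < p \<Longrightarrow> f q = g q"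
  shows "map f ps < map g ps"
  using assms
proof (induction ps)
  case (Cons q ps)
  then show ?case by (cases "q = p") auto
qed simp

lemma sorted_wrt_product:
  fixes xs :: "'a::linorder list" and ys :: "'b::linorder list"
  assumes "sorted_wrt (<) xs" "sorted_wrt (<) ys"
  shows "sorted_wrt (<) (List.product xs ys)"
  using assms(1)
  by (induction xs) (use assms(2) in \<open>auto simp: sorted_wrt_append sorted_wrt_map\<close>)

text \<open>The map undoes the increasing enumeration of \<open>B\<close> and then applies the
  increasing enumeration of \<open>C\<close>.\<close>

lemma ex_strict_mono_on_image:
  fixes B C :: "nat set"
  assumes "finite B" "finite C" "card B = card C"
  shows "\<exists>h. h ` B = C \<and> strict_mono_on B h"
proof -
  obtain f where f: "bij_betw f {..<card B} B" "strict_mono_on {..<card B} f"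
    using ex_bij_betw_strict_mono_card[OF assms(1)] .
  obtain g where g: "bij_betw g {..<card B} C" "strict_mono_on {..<card B} g"
    using ex_bij_betw_strict_mono_card[OF assms(2)] assms(3) by metis
  let ?f' = "inv_into {..<card B} f"
  have f': "bij_betw ?f' B {..<card B}" by (rule bij_betw_inv_into[OF f(1)])
  have "strict_mono_on B ?f'"
  proof (rule strict_mono_onI)
    fix a b assume ab: "a \<in> B" "b \<in> B" "a < b"
    have "?f' a \<in> {..<card B}" "?f' b \<in> {..<card B}" using f' ab bij_betwE by blast+
    moreover have "f (?f' a) < f (?f' b)"
      using ab bij_betw_inv_into_right[OF f(1)] by simp
    ultimately show "?f' a < ?f' b" using strict_mono_on_less[OF f(2)] by blast
  qed
  then have "strict_mono_on B (g \<circ> ?f')"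
    using g(2) bij_betwE[OF f'] by (simp add: strict_mono_on_def)
  moreover have "(g \<circ> ?f') ` B = C"
    using f' g(1) by (metis bij_betw_def bij_betw_trans)
  ultimately show ?thesis by blast
qed

text \<open>Write f k = g m with m in C. If m < k, then f m = g m = f k contradicts injectivity; so
  k <= m, and g is increasing. This one comparison yields both the minimality of A(x) among the
  atoms below x and the decrease of entries along the order.\<close>

lemma strict_mono_on_le_at_first_deviation:
  fixes f g :: "nat \<Rightarrow> nat"
  assumes "strict_mono_on C g" "inj_on f C" "k \<in> C" "f k \<in> g ` C"
    and agree: "\<And>k'. k' \<in> C \<Longrightarrow> k' < k \<Longrightarrow> f k' = g k'"
  shows "g k \<le> f k"
proof -
  obtain m where m: "m \<in> C" "f k = g m" using assms(4) by blast
  have "k \<le> m"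
  proof (rule ccontr)
    assume "\<not> k \<le> m"
    then show False using agree[OF m(1)] m inj_onD[OF assms(2), of m k] assms(3) by auto
  qed
  then show ?thesis using strict_mono_on_leD[OF assms(1,3) m(1)] m(2) by simp
qed

section \<open>The order on vector partitions\<close>

lemma partition_on_merge:
  assumes "partition_on A P" "I \<in> P" "J \<in> P"
  shows "partition_on A (insert (I \<union> J) (P - {I, J}))"
proof (rule partition_onI)
  show "\<Union>(insert (I \<union> J) (P - {I, J})) = A" using assms partition_onD1 by fastforce
  show "{} \<notin> insert (I \<union> J) (P - {I, J})" using assms partition_onD3 by fastforce
  show "disjnt p q" if "p \<in> insert (I \<union> J) (P - {I, J})" "q \<in> insert (I \<union> J) (P - {I, J})" "p \<noteq> q"
    for p q
    using that assms partition_onD2[OF assms(1)] by (auto simp: disjoint_def disjnt_def)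
qed

locale vector_partition_order =
  fixes n s :: nat
begin

abbreviation "V \<equiv> vector_partitions n s - {Bot}"

lemma vector_partitionD:
  assumes "x \<in> V"
  shows "partition_on {1..n} (parts x)"
    and "i \<in> {1..s} \<Longrightarrow> inj_on (plabel x i) (parts x)"
    and "i \<in> {1..s} \<Longrightarrow> partition_on {1..n} (plabel x i ` parts x)"
    and "i \<in> {1..s} \<Longrightarrow> B \<in> parts x \<Longrightarrow> card (plabel x i B) = card B"
    and "i \<notin> {1..s} \<Longrightarrow> plabel x i = undefined"
    and "i \<in> {1..s} \<Longrightarrow> B \<notin> parts x \<Longrightarrow> plabel x i B = undefined"
  using assms by (auto simp: vector_partitions_def PiE_iff extensional_def)

text \<open>A label has the size of its nonempty part and is therefore nonempty. Disjoint nonempty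
  labels are distinct, which gives injectivity of \<open>w i\<close> and the partition property of
  its image.\<close>

lemma vector_partitionI:
  assumes "partition_on {1..n} P"
    and "\<And>i. i \<notin> {1..s} \<Longrightarrow> w i = undefined"
    and "\<And>i B. i \<in> {1..s} \<Longrightarrow> B \<notin> P \<Longrightarrow> w i B = undefined"
    and card: "\<And>i B. i \<in> {1..s} \<Longrightarrow> B \<in> P \<Longrightarrow> card (w i B) = card B"
    and Un: "\<And>i. i \<in> {1..s} \<Longrightarrow> (\<Union>B\<in>P. w i B) = {1..n}"
    and disj: "\<And>i B C. i \<in> {1..s} \<Longrightarrow> B \<in> P \<Longrightarrow> C \<in> P \<Longrightarrow> B \<noteq> C \<Longrightarrow> w i B \<inter> w i C = {}"
  shows "VP P w \<in> V"
proof -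
  have fin: "finite B" "B \<noteq> {}" if "B \<in> P" for B
    using that partition_onD1[OF assms(1)] partition_onD3[OF assms(1)]
    by (metis Sup_upper finite_atLeastAtMost finite_subset, blast)
  have ne: "w i B \<noteq> {}" if "i \<in> {1..s}" "B \<in> P" for i B
    using card[OF that] fin[OF that(2)] by auto
  have "w \<in> (\<Pi>\<^sub>E i\<in>{1..s}. \<Pi>\<^sub>E B\<in>P. {C. C \<subseteq> {1..n} \<and> card C = card B})"
  proof (intro PiE_I CollectI conjI)
    show "w i B \<subseteq> {1..n}" if "i \<in> {1..s}" "B \<in> P" for i B using Un that by blast
  qed (use assms(2,3) card in auto)
  moreover have "inj_on (w i) P" if "i \<in> {1..s}" for i
    using disj[OF that] ne[OF that] by (metis inf.idem inj_onI)
  moreover have "partition_on {1..n} (w i ` P)" if "i \<in> {1..s}" for i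
  proof (rule partition_onI)
    show "\<Union> (w i ` P) = {1..n}" using Un[OF that] .
    show "{} \<notin> w i ` P" using ne[OF that] by (metis imageE)
    show "disjnt p q" if "p \<in> w i ` P" "q \<in> w i ` P" "p \<noteq> q" for p q
      using that disj[OF \<open>i \<in> {1..s}\<close>] unfolding disjnt_def by blast
  qed
  ultimately show ?thesis using assms(1) by (auto simp: vector_partitions_def)
qed

lemma part_exists: "x \<in> V \<Longrightarrow> k \<in> {1..n} \<Longrightarrow> \<exists>B\<in>parts x. k \<in> B"
  using partition_onD1[OF vector_partitionD(1)] by blast

lemma part_unique: "\<lbrakk>x \<in> V; B \<in> parts x; C \<in> parts x; k \<in> B; k \<in> C\<rbrakk> \<Longrightarrow> B = C"
  using partition_onD2[OF vector_partitionD(1)] by (auto simp: disjoint_def)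

lemma part_subset: "x \<in> V \<Longrightarrow> B \<in> parts x \<Longrightarrow> B \<subseteq> {1..n}"
  using partition_onD1[OF vector_partitionD(1)] by blast

lemma finite_part: "x \<in> V \<Longrightarrow> B \<in> parts x \<Longrightarrow> finite B"
  using part_subset finite_subset by blast

lemma part_nonempty: "x \<in> V \<Longrightarrow> B \<in> parts x \<Longrightarrow> B \<noteq> {}"
  using partition_onD3[OF vector_partitionD(1)] by blast

lemma label_exists: "\<lbrakk>x \<in> V; i \<in> {1..s}; j \<in> {1..n}\<rbrakk> \<Longrightarrow> \<exists>B\<in>parts x. j \<in> plabel x i B"
  using partition_onD1[OF vector_partitionD(3)] by blast

lemma label_unique:
  assumes "x \<in> V" "i \<in> {1..s}" "B \<in> parts x" "C \<in> parts x" "j \<in> plabel x i B" "j \<in> plabel x i C"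
  shows "B = C"
proof -
  have "plabel x i B = plabel x i C"
    using partition_onD2[OF vector_partitionD(3)[OF assms(1,2)]] assms(3-6)
    by (auto simp: disjoint_def)
  then show ?thesis using inj_onD[OF vector_partitionD(2)[OF assms(1,2)]] assms(3,4) by blast
qed

lemma label_subset: "\<lbrakk>x \<in> V; i \<in> {1..s}; B \<in> parts x\<rbrakk> \<Longrightarrow> plabel x i B \<subseteq> {1..n}"
  using partition_onD1[OF vector_partitionD(3)] by blast

lemma finite_label: "\<lbrakk>x \<in> V; i \<in> {1..s}; B \<in> parts x\<rbrakk> \<Longrightarrow> finite (plabel x i B)"
  by (meson label_subset finite_subset finite_atLeastAtMost)

lemma vector_partition_eqI:
  assumes "x \<in> V" "y \<in> V" "parts x = parts y"
    and "\<And>i B. i \<in> {1..s} \<Longrightarrow> B \<in> parts x \<Longrightarrow> plabel x i B = plabel y i B"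
  shows "x = y"
proof -
  have "plabel x i B = plabel y i B" for i B
    using assms vector_partitionD(5)[of x i] vector_partitionD(5)[of y i]
      vector_partitionD(6)[of x i B] vector_partitionD(6)[of y i B]
    by (cases "i \<in> {1..s}"; cases "B \<in> parts x") auto
  then show ?thesis using assms(1-3) by (cases x; cases y) (auto intro!: ext)
qed

text \<open>Parts and i-th labels each cover [n] without overlap. Hence a part of \<open>x\<close>
  that meets a part \<open>C\<close> of \<open>y\<close>, in an element or in an element of a label,
  must be included in this very \<open>C\<close>, and inclusions alone force the unions in
  \<open>vp_le\<close> to be exact.\<close>

lemma vp_le_iff:
  assumes x: "x \<in> V" and y: "y \<in> V"
  shows "vp_le s x y \<longleftrightarrow>
    (\<forall>B\<in>parts x. \<exists>C\<in>parts y. B \<subseteq> C \<and> (\<forall>i\<in>{1..s}. plabel x i B \<subseteq> plabel y i C))" (is "_ \<longleftrightarrow> ?R")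
proof -
  have le: "vp_le s x y \<longleftrightarrow> (\<forall>C\<in>parts y. (\<exists>S\<subseteq>parts x. C = \<Union>S) \<and>
        (\<forall>i\<in>{1..s}. plabel y i C = \<Union>{plabel x i B | B. B \<in> parts x \<and> B \<subseteq> C}))"
    using x y by (cases x; cases y) auto
  show ?thesis
  proof
    assume L: "vp_le s x y"
    show ?R
    proof
      fix B assume B: "B \<in> parts x"
      then obtain k where k: "k \<in> B" using part_nonempty[OF x] by blast
      then obtain C where C: "C \<in> parts y" "k \<in> C"
        using part_exists[OF y] part_subset[OF x B] by blast
      then obtain S where S: "S \<subseteq> parts x" "C = \<Union>S" using L[unfolded le] by metis
      then obtain B' where "B' \<in> S" "k \<in> B'" using C by blast
      then have "B' = B" using part_unique[OF x] B k S by blast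
      then have "B \<subseteq> C" using S \<open>B' \<in> S\<close> by blast
      then show "\<exists>C\<in>parts y. B \<subseteq> C \<and> (\<forall>i\<in>{1..s}. plabel x i B \<subseteq> plabel y i C)"
        using C(1) L le B by (intro bexI[of _ C]) auto
    qed
  next
    assume R: ?R
    have sub: "B \<subseteq> C \<and> (\<forall>i\<in>{1..s}. plabel x i B \<subseteq> plabel y i C)"
      if B: "B \<in> parts x" and C: "C \<in> parts y"
        and meet: "B \<inter> C \<noteq> {} \<or> (\<exists>i\<in>{1..s}. plabel x i B \<inter> plabel y i C \<noteq> {})" for B C
    proof -
      obtain D where D: "D \<in> parts y" "B \<subseteq> D" "\<forall>i\<in>{1..s}. plabel x i B \<subseteq> plabel y i D"
        using R B by blast
      have "C = D" using meet part_unique[OF y C D(1)] label_unique[OF y _ C D(1)] D by blast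
      then show ?thesis using D by blast
    qed
    show "vp_le s x y" unfolding le
    proof (intro ballI conjI)
      fix C assume C: "C \<in> parts y"
      have "C = \<Union>{B \<in> parts x. B \<subseteq> C}"
      proof
        show "C \<subseteq> \<Union>{B \<in> parts x. B \<subseteq> C}"
        proof
          fix k assume k: "k \<in> C"
          then obtain B where B: "B \<in> parts x" "k \<in> B"
            using part_exists[OF x] part_subset[OF y C] by blast
          then show "k \<in> \<Union>{B \<in> parts x. B \<subseteq> C}" using sub[OF B(1) C] k by blast
        qed
      qed blast
      then show "\<exists>S\<subseteq>parts x. C = \<Union>S"
        by (intro exI[of _ "{B \<in> parts x. B \<subseteq> C}"] conjI) auto
      fix i assume i: "i \<in> {1..s}"
      show "plabel y i C = \<Union>{plabel x i B | B. B \<in> parts x \<and> B \<subseteq> C}"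
      proof
        show "plabel y i C \<subseteq> \<Union>{plabel x i B | B. B \<in> parts x \<and> B \<subseteq> C}"
        proof
          fix j assume j: "j \<in> plabel y i C"
          then obtain B where B: "B \<in> parts x" "j \<in> plabel x i B"
            using label_exists[OF x i subsetD[OF label_subset[OF y i C]]] by blast
          then have "B \<subseteq> C" using sub[OF B(1) C] i j by blast
          then show "j \<in> \<Union>{plabel x i B | B. B \<in> parts x \<and> B \<subseteq> C}" using B by blast
        qed
        have "plabel x i B \<subseteq> plabel y i C" if "B \<in> parts x" "B \<subseteq> C" for B
          using sub[OF that(1) C] part_nonempty[OF x that(1)] that i by blast
        then show "\<Union>{plabel x i B | B. B \<in> parts x \<and> B \<subseteq> C} \<subseteq> plabel y i C" by blast
      qed
    qed
  qed
qed

text \<open>The part of \<open>y\<close> above \<open>B\<close> is unique, and one common element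
  identifies it. The disjunctive premise admits such an element either in the parts themselves or in
  one of the labels.\<close>

lemma vp_leD:
  assumes "x \<in> V" "y \<in> V" "vp_le s x y" "B \<in> parts x" "C \<in> parts y"
    and "k \<in> B \<and> k \<in> C \<or> i' \<in> {1..s} \<and> j \<in> plabel x i' B \<and> j \<in> plabel y i' C"
  shows "B \<subseteq> C" "i \<in> {1..s} \<Longrightarrow> plabel x i B \<subseteq> plabel y i C"
proof -
  obtain D where D: "D \<in> parts y" "B \<subseteq> D" "\<forall>i\<in>{1..s}. plabel x i B \<subseteq> plabel y i D"
    using assms vp_le_iff by meson
  have "C = D"
    using assms(6) part_unique[OF assms(2,5) D(1)] label_unique[OF assms(2) _ assms(5) D(1)] D
    by blast
  then show "B \<subseteq> C" "i \<in> {1..s} \<Longrightarrow> plabel x i B \<subseteq> plabel y i C" using D by auto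
qed

lemma vp_le_refl_V: "x \<in> V \<Longrightarrow> vp_le s x x"
  by (auto simp: vp_le_iff)

lemma vp_le_trans_V:
  assumes "x \<in> V" "y \<in> V" "z \<in> V" "vp_le s x y" "vp_le s y z"
  shows "vp_le s x z"
  using assms(4,5) unfolding vp_le_iff[OF assms(1,2)] vp_le_iff[OF assms(2,3)]
    vp_le_iff[OF assms(1,3)] by (meson order_trans)

lemma vp_le_antisym_V:
  assumes x: "x \<in> V" and y: "y \<in> V" and le: "vp_le s x y" "vp_le s y x"
  shows "x = y"
proof -
  \<comment> \<open>Stated for a generic pair so that it applies in both directions. From B to C in
    \<open>v\<close> and back to D in \<open>u\<close>, disjointness of parts gives B = D and hence
    B = C.\<close>
  have "B \<in> parts v \<and> (\<forall>i\<in>{1..s}. plabel u i B \<subseteq> plabel v i B)"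
    if u: "u \<in> V" and v: "v \<in> V" and le: "vp_le s u v" "vp_le s v u" and B: "B \<in> parts u" for u v B
  proof -
    obtain C where C: "C \<in> parts v" "B \<subseteq> C" "\<forall>i\<in>{1..s}. plabel u i B \<subseteq> plabel v i C"
      using le B vp_le_iff[OF u v] by blast
    obtain D where D: "D \<in> parts u" "C \<subseteq> D" using C le vp_le_iff[OF v u] by blast
    have "B = D" using part_unique[OF u B D(1)] part_nonempty[OF u B] C D by blast
    then show ?thesis using C D by (metis subset_antisym)
  qed
  from this[OF x y le] this[OF y x le(2,1)]
  show ?thesis by (intro vector_partition_eqI x y) blast+
qed

section \<open>Finiteness and the order axioms, with \<open>Bot\<close> included\<close>

lemma finite_vector_partitions: "finite (vector_partitions n s)"
proof -
  let ?W = "\<lambda>P. \<Pi>\<^sub>E i\<in>{1..s}. \<Pi>\<^sub>E B\<in>P. {C. C \<subseteq> {1..n} \<and> card C = card B}"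
  have "finite P" if "partition_on {1..n} P" for P
    using that finite_elements by blast
  then have "finite (Sigma {P. partition_on {1..n} P} ?W)"
    by (intro finite_SigmaI finite_PiE finitely_many_partition_on) auto
  moreover have "vector_partitions n s \<subseteq>
      insert Bot ((\<lambda>(P, w). VP P w) ` Sigma {P. partition_on {1..n} P} ?W)"
    unfolding vector_partitions_def by auto
  ultimately show ?thesis by (meson finite.insertI finite_imageI finite_subset)
qed

lemma vp_le_Bot_iff: "vp_le s x Bot \<longleftrightarrow> x = Bot"
  by (cases x) auto

sublocale finite_order "vector_partitions n s" "vp_le s"
proof
  show "finite (vector_partitions n s)" by (rule finite_vector_partitions)
  show "vp_le s x x" if "x \<in> vector_partitions n s" for x
    using that vp_le_refl_V by (cases "x = Bot") auto
  show "x = y" if "x \<in> vector_partitions n s" "y \<in> vector_partitions n s" "vp_le s x y" "vp_le s y x"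
    for x y
  proof (cases "x = Bot \<or> y = Bot")
    case True
    then show ?thesis using that(3,4) by (auto simp: vp_le_Bot_iff)
  next
    case False
    then show ?thesis using that vp_le_antisym_V by blast
  qed
  show "vp_le s x z" if "x \<in> vector_partitions n s" "y \<in> vector_partitions n s"
    "z \<in> vector_partitions n s" "vp_le s x y" "vp_le s y z" for x y z
  proof (cases "x = Bot \<or> y = Bot \<or> z = Bot")
    case True
    then show ?thesis using that vp_le_Bot_iff vp_le.simps(1) by metis
  next
    case False
    then show ?thesis by (intro vp_le_trans_V[of x y z]) (use that in auto)
  qed
qed

section \<open>Least atoms and their entries\<close>

text \<open>This is the explicit description of A(x), with \<open>e i k\<close> in the role of the
  entry in row i at position k. It is kept apart from \<open>least_atom\<close>, which is defined by
  minimality; \<open>least_atom_eq\<close> joins the two.\<close>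

definition sorted_labels :: "vpart \<Rightarrow> (nat \<Rightarrow> nat \<Rightarrow> nat) \<Rightarrow> bool" where
  "sorted_labels x e \<longleftrightarrow>
    (\<forall>i\<in>{1..s}. \<forall>B\<in>parts x. e i ` B = plabel x i B \<and> strict_mono_on B (e i))"

text \<open>Serves to glue increasing bijections given separately on each part into one function per
  row.\<close>

lemma sorted_labels_cong:
  assumes "\<And>i B. i \<in> {1..s} \<Longrightarrow> B \<in> parts x \<Longrightarrow> h i B ` B = plabel x i B \<and> strict_mono_on B (h i B)"
    and "\<And>i B k. i \<in> {1..s} \<Longrightarrow> B \<in> parts x \<Longrightarrow> k \<in> B \<Longrightarrow> e i k = h i B k"
  shows "sorted_labels x e"
  unfolding sorted_labels_def
proof (intro ballI conjI)
  fix i B assume iB: "i \<in> {1..s}" "B \<in> parts x"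
  have "e i ` B = h i B ` B" using assms(2)[OF iB] by (rule image_cong[OF refl])
  then show "e i ` B = plabel x i B" using assms(1)[OF iB] by simp
  show "strict_mono_on B (e i)"
    using assms(1)[OF iB] assms(2)[OF iB] by (simp add: strict_mono_on_def)
qed

lemma sorted_labels_exists:
  assumes x: "x \<in> V"
  shows "\<exists>e. sorted_labels x e"
proof -
  have "\<forall>i B. \<exists>h. i \<in> {1..s} \<longrightarrow> B \<in> parts x \<longrightarrow> h ` B = plabel x i B \<and> strict_mono_on B h"
    using ex_strict_mono_on_image finite_part[OF x] finite_label[OF x] vector_partitionD(4)[OF x]
    by metis
  then obtain h where h: "\<And>i B. i \<in> {1..s} \<Longrightarrow> B \<in> parts x \<Longrightarrow>
      h i B ` B = plabel x i B \<and> strict_mono_on B (h i B)"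
    by metis
  define e where "e i k = h i (THE B. B \<in> parts x \<and> k \<in> B) k" for i k
  have "e i k = h i B k" if "B \<in> parts x" "k \<in> B" for i k B
  proof -
    have "(THE B. B \<in> parts x \<and> k \<in> B) = B"
      by (rule the_equality) (simp add: that, metis part_unique[OF x] that)
    then show ?thesis by (simp add: e_def)
  qed
  then have "sorted_labels x e"
    by (intro sorted_labels_cong[of x "\<lambda>i B. h i B"]) (use h in auto)
  then show ?thesis by blast
qed

text \<open>The labels cover [n], so each row maps [n] onto itself, and a surjection of a finite set
  onto itself is injective.\<close>

lemma sorted_labels_bij:
  assumes x: "x \<in> V" and e: "sorted_labels x e" and i: "i \<in> {1..s}"
  shows "bij_betw (e i) {1..n} {1..n}"
proof -
  have lab: "e i ` B = plabel x i B" "strict_mono_on B (e i)" if "B \<in> parts x" for B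
    using e i that by (auto simp: sorted_labels_def)
  have "{1..n} \<subseteq> e i ` {1..n}"
  proof
    fix j assume "j \<in> {1..n}"
    then obtain B where "B \<in> parts x" "j \<in> plabel x i B" using label_exists[OF x i] by blast
    then show "j \<in> e i ` {1..n}" using lab part_subset[OF x] by blast
  qed
  moreover have "e i k \<in> {1..n}" if k: "k \<in> {1..n}" for k
  proof -
    obtain B where "B \<in> parts x" "k \<in> B" using part_exists[OF x k] by blast
    then show ?thesis using lab label_subset[OF x i] by blast
  qed
  ultimately have "e i ` {1..n} = {1..n}" by blast
  then show ?thesis by (simp add: bij_betw_def eq_card_imp_inj_on)
qed

section \<open>Atoms, their entries and the comparison of their words\<close>

lemma atomD:
  assumes "a \<in> atoms n s"
  shows "a \<in> V" "parts a = (\<lambda>k. {k}) ` {1..n}"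
    and "i \<in> {1..s} \<Longrightarrow> k \<in> {1..n} \<Longrightarrow> plabel a i {k} = {atom_entry a i k}"
proof -
  show a: "a \<in> V" and p: "parts a = (\<lambda>k. {k}) ` {1..n}" using assms by (auto simp: atoms_def)
  assume "i \<in> {1..s}" "k \<in> {1..n}"
  then have "card (plabel a i {k}) = 1" using vector_partitionD(4)[OF a, of i "{k}"] p by auto
  then show "plabel a i {k} = {atom_entry a i k}"
    unfolding atom_entry_def by (metis card_1_singletonE the_elem_eq)
qed

lemma atom_eqI:
  assumes a: "a \<in> atoms n s" and b: "b \<in> atoms n s"
    and "\<And>i k. i \<in> {1..s} \<Longrightarrow> k \<in> {1..n} \<Longrightarrow> atom_entry a i k = atom_entry b i k"
  shows "a = b"
  using atomD[OF a] atomD[OF b] assms(3) by (intro vector_partition_eqI) auto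

lemma sorted_labels_atom:
  assumes "a \<in> atoms n s"
  shows "sorted_labels a (atom_entry a)"
  using atomD[OF assms] by (auto simp: sorted_labels_def strict_mono_on_def)

lemma atom_le_iff:
  assumes a: "a \<in> atoms n s" and x: "x \<in> V"
  shows "vp_le s a x \<longleftrightarrow> (\<forall>i\<in>{1..s}. \<forall>B\<in>parts x. \<forall>k\<in>B. atom_entry a i k \<in> plabel x i B)"
    (is "_ \<longleftrightarrow> ?R")
proof
  assume L: "vp_le s a x"
  show ?R
  proof (intro ballI)
    fix i B k assume i: "i \<in> {1..s}" and B: "B \<in> parts x" and k: "k \<in> B"
    have kn: "k \<in> {1..n}" using part_subset[OF x B] k by blast
    have "plabel a i {k} \<subseteq> plabel x i B"
      by (rule vp_leD(2)[OF atomD(1)[OF a] x L _ B _ i]) (use atomD(2)[OF a] kn k in auto)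
    then show "atom_entry a i k \<in> plabel x i B" using atomD(3)[OF a i kn] by simp
  qed
next
  assume R: ?R
  show "vp_le s a x"
    unfolding vp_le_iff[OF atomD(1)[OF a] x]
  proof
    fix B assume "B \<in> parts a"
    then obtain k where k: "k \<in> {1..n}" "B = {k}" using atomD(2)[OF a] by blast
    obtain C where C: "C \<in> parts x" "k \<in> C" using part_exists[OF x k(1)] by blast
    have "\<forall>i\<in>{1..s}. plabel a i B \<subseteq> plabel x i C"
      using R C k atomD(3)[OF a _ k(1)] by simp
    then show "\<exists>C\<in>parts x. B \<subseteq> C \<and> (\<forall>i\<in>{1..s}. plabel a i B \<subseteq> plabel x i C)"
      using C k(2) by blast
  qed
qed

definition atom_of :: "(nat \<Rightarrow> nat \<Rightarrow> nat) \<Rightarrow> vpart" where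
  "atom_of e = VP ((\<lambda>k. {k}) ` {1..n})
     (\<lambda>i\<in>{1..s}. \<lambda>B\<in>(\<lambda>k. {k}) ` {1..n}. e i ` B)"

lemma atom_of_in_atoms:
  assumes bij: "\<And>i. i \<in> {1..s} \<Longrightarrow> bij_betw (e i) {1..n} {1..n}"
  shows "atom_of e \<in> atoms n s"
proof -
  have "atom_of e \<in> V"
    unfolding atom_of_def
  proof (rule vector_partitionI)
    show "partition_on {1..n} ((\<lambda>k. {k}) ` {1..n})" by (rule partition_on_singletons)
    fix i assume i: "i \<in> {1..s}"
    have e: "e i ` {1..n} = {1..n}" "inj_on (e i) {1..n}" using bij[OF i] by (auto simp: bij_betw_def)
    let ?w = "\<lambda>i\<in>{1..s}. \<lambda>B\<in>(\<lambda>k. {k}) ` {1..n}. e i ` B"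
    have w: "?w i {k} = {e i k}" if "k \<in> {1..n}" for k using i that by simp
    have "(\<Union>B\<in>(\<lambda>k. {k}) ` {1..n}. ?w i B) = (\<Union>k\<in>{1..n}. {e i k})"
      using w by (simp only: UN_simps image_image) simp
    then show "(\<Union>B\<in>(\<lambda>k. {k}) ` {1..n}. ?w i B) = {1..n}" using e(1) by auto
    fix B assume "B \<in> (\<lambda>k. {k}) ` {1..n}"
    then obtain k where k: "k \<in> {1..n}" "B = {k}" by blast
    show "card (?w i B) = card B" using w[OF k(1)] k(2) by simp
    fix C assume "C \<in> (\<lambda>k. {k}) ` {1..n}" "B \<noteq> C"
    then obtain l where l: "l \<in> {1..n}" "C = {l}" "k \<noteq> l" using k by blast
    then show "?w i B \<inter> ?w i C = {}"
      using w[OF k(1)] w[OF l(1)] k l inj_onD[OF e(2), of k l] by auto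
  qed (auto simp: restrict_def)
  then show ?thesis by (auto simp: atoms_def atom_of_def)
qed

lemma atom_entry_atom_of: "i \<in> {1..s} \<Longrightarrow> k \<in> {1..n} \<Longrightarrow> atom_entry (atom_of e) i k = e i k"
  by (auto simp: atom_entry_def atom_of_def)

lemma atom_word_eq_map:
  "atom_word n s a = map (\<lambda>(i, k). atom_entry a i k) (List.product [1..<Suc s] [1..<Suc n])"
  by (simp add: atom_word_def product_concat_map map_concat o_def del: upt_Suc)

text \<open>A word lists its entries in the lexicographic order of the pairs (i, k), so two words
  are decided at the least pair where they differ. There all earlier entries of row i agree, which
  is what the premise \<open>le\<close> asks for.\<close>

lemma atom_word_less:
  assumes a: "a \<in> atoms n s" and b: "b \<in> atoms n s" and ne: "a \<noteq> b"
    and le: "\<And>i k. \<lbrakk>i \<in> {1..s}; k \<in> {1..n}; \<And>k'. k' \<in> {1..n} \<Longrightarrow> k' < k \<Longrightarrow>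
      atom_entry a i k' = atom_entry b i k'\<rbrakk> \<Longrightarrow> atom_entry a i k \<le> atom_entry b i k"
  shows "atom_word n s a < atom_word n s b"
proof -
  define ps where "ps = List.product [1..<Suc s] [1..<Suc n]"
  define f where "f a = (\<lambda>(i, k). atom_entry a i k)" for a
  have ps: "set ps = {1..s} \<times> {1..n}" unfolding ps_def by auto
  have word: "atom_word n s c = map (f c) ps" for c
    by (simp add: atom_word_eq_map ps_def f_def)
  have "\<exists>p. p \<in> set ps \<and> f a p \<noteq> f b p"
  proof (rule ccontr)
    assume eq: "\<not> ?thesis"
    have "atom_entry a i k = atom_entry b i k" if "i \<in> {1..s}" "k \<in> {1..n}" for i k
    proof -
      have "(i, k) \<in> set ps" using that ps by blast
      then have "f a (i, k) = f b (i, k)" using eq by blast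
      then show ?thesis by (simp add: f_def)
    qed
    then show False using atom_eqI[OF a b] ne by blast
  qed
  then obtain p where p: "p \<in> set ps" "f a p \<noteq> f b p"
    and least: "\<And>q. q < p \<Longrightarrow> q \<in> set ps \<Longrightarrow> f a q = f b q"
    using exists_least_iff[of "\<lambda>p. p \<in> set ps \<and> f a p \<noteq> f b p"] by metis
  obtain i k where ik: "p = (i, k)" "i \<in> {1..s}" "k \<in> {1..n}" using p(1) unfolding ps by blast
  have "atom_entry a i k' = atom_entry b i k'" if "k' \<in> {1..n}" "k' < k" for k'
  proof -
    have "(i, k') \<in> set ps" "(i, k') < p" using that ik ps by auto
    then show ?thesis using least[of "(i, k')"] by (simp add: f_def)
  qed
  then have "atom_entry a i k \<le> atom_entry b i k" using le ik(2,3) by blast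
  then have "f a p < f b p" using p(2) by (simp add: f_def ik(1))
  moreover have "sorted_wrt (<) ps" unfolding ps_def by (intro sorted_wrt_product sorted_wrt_upt)
  ultimately show ?thesis
    unfolding word using p(1) least by (intro map_less_map[of ps p])
qed

text \<open>Minimality is checked row by row. An atom below \<open>x\<close> sends each part into
  its i-th label, while \<open>e i\<close> lists that label in increasing order, so at the first
  deviation in a row the competitor has the larger entry.\<close>

lemma atom_of_sorted_labels_le:
  assumes x: "x \<in> V" and e: "sorted_labels x e"
  shows "atom_of e \<in> atoms n s" "vp_le s (atom_of e) x"
    and "\<lbrakk>b \<in> atoms n s; vp_le s b x; b \<noteq> atom_of e\<rbrakk> \<Longrightarrow> atom_word n s (atom_of e) < atom_word n s b"
proof -
  show atom: "atom_of e \<in> atoms n s"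
    using atom_of_in_atoms sorted_labels_bij[OF x e] by blast
  have entry: "atom_entry (atom_of e) i k \<in> plabel x i B"
    if "i \<in> {1..s}" "B \<in> parts x" "k \<in> B" for i B k
  proof -
    have "e i k \<in> plabel x i B" using e that unfolding sorted_labels_def by blast
    then show ?thesis using atom_entry_atom_of[OF that(1)] part_subset[OF x that(2)] that(3) by auto
  qed
  then show "vp_le s (atom_of e) x" unfolding atom_le_iff[OF atom x] by blast
  assume b: "b \<in> atoms n s" "vp_le s b x" "b \<noteq> atom_of e"
  show "atom_word n s (atom_of e) < atom_word n s b"
  proof (rule atom_word_less[OF atom b(1) b(3)[symmetric]])
    fix i k assume i: "i \<in> {1..s}" and k: "k \<in> {1..n}"
      and agree: "\<And>k'. k' \<in> {1..n} \<Longrightarrow> k' < k \<Longrightarrow> atom_entry (atom_of e) i k' = atom_entry b i k'"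
    obtain B where B: "B \<in> parts x" "k \<in> B" using part_exists[OF x k] by blast
    have Bn: "B \<subseteq> {1..n}" using part_subset[OF x B(1)] .
    have "e i k \<le> atom_entry b i k"
    proof (rule strict_mono_on_le_at_first_deviation[where C = B and g = "e i"])
      show "strict_mono_on B (e i)" "atom_entry b i k \<in> e i ` B"
        using e i B b(2) unfolding sorted_labels_def atom_le_iff[OF b(1) x] by blast+
      show "inj_on (atom_entry b i) B"
        using sorted_labels_bij[OF atomD(1)[OF b(1)] sorted_labels_atom[OF b(1)] i] Bn
        by (meson bij_betw_imp_inj_on inj_on_subset)
    qed (use B Bn agree atom_entry_atom_of[OF i] in auto)
    then show "atom_entry (atom_of e) i k \<le> atom_entry b i k"
      using atom_entry_atom_of[OF i k] by simp
  qed
qed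

text \<open>The strict inequality between words makes the minimizer unique, so the choice hidden in
  \<open>arg_min_on\<close> is determined.\<close>

lemma least_atom_eq:
  assumes x: "x \<in> V" and e: "sorted_labels x e"
  shows "least_atom n s x = atom_of e"
proof -
  note least = atom_of_sorted_labels_le[OF x e]
  have "is_arg_min (atom_word n s) (\<lambda>a. a \<in> {a \<in> atoms n s. vp_le s a x}) b \<longleftrightarrow> b = atom_of e" for b
    unfolding is_arg_min_def using least by (metis (mono_tags, lifting) mem_Collect_eq order_less_asym)
  then show ?thesis by (simp add: least_atom_def arg_min_on_def arg_min_def)
qed

lemma least_atom:
  assumes x: "x \<in> V"
  shows "least_atom n s x \<in> atoms n s" "vp_le s (least_atom n s x) x"
    and "\<lbrakk>b \<in> atoms n s; vp_le s b x; b \<noteq> least_atom n s x\<rbrakk> \<Longrightarrow>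
      atom_word n s (least_atom n s x) < atom_word n s b"
  using sorted_labels_exists[OF x] atom_of_sorted_labels_le[OF x] least_atom_eq[OF x] by metis+

lemma sorted_labels_entry:
  assumes x: "x \<in> V"
  shows "sorted_labels x (entry n s x)"
proof -
  obtain e where e: "sorted_labels x e" using sorted_labels_exists[OF x] by blast
  have "entry n s x i k = e i k" if "i \<in> {1..s}" "B \<in> parts x" "k \<in> B" for i k B
    using atom_entry_atom_of[OF that(1)] part_subset[OF x that(2)] that(3) least_atom_eq[OF x e]
    by (auto simp: entry_def)
  then show ?thesis
    by (intro sorted_labels_cong[of x "\<lambda>i B. e i"]) (use e in \<open>auto simp: sorted_labels_def\<close>)
qed

lemma entry_image: "\<lbrakk>x \<in> V; i \<in> {1..s}; B \<in> parts x\<rbrakk> \<Longrightarrow> entry n s x i ` B = plabel x i B"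
  using sorted_labels_entry by (auto simp: sorted_labels_def)

lemma entry_strict_mono_on: "\<lbrakk>x \<in> V; i \<in> {1..s}; B \<in> parts x\<rbrakk> \<Longrightarrow> strict_mono_on B (entry n s x i)"
  using sorted_labels_entry by (auto simp: sorted_labels_def)

lemma entry_bij: "\<lbrakk>x \<in> V; i \<in> {1..s}\<rbrakk> \<Longrightarrow> bij_betw (entry n s x i) {1..n} {1..n}"
  using sorted_labels_bij sorted_labels_entry by blast

lemma entry_inj:
  "\<lbrakk>x \<in> V; i \<in> {1..s}; k \<in> {1..n}; k' \<in> {1..n}; entry n s x i k = entry n s x i k'\<rbrakk> \<Longrightarrow> k = k'"
  using entry_bij by (meson bij_betw_imp_inj_on inj_onD)

lemma least_atom_eq_iff:
  assumes x: "x \<in> V" and y: "y \<in> V"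
  shows "least_atom n s x = least_atom n s y \<longleftrightarrow>
    (\<forall>i\<in>{1..s}. \<forall>k\<in>{1..n}. entry n s x i k = entry n s y i k)"
  using atom_eqI[OF least_atom(1)[OF x] least_atom(1)[OF y]] by (auto simp: entry_def)

lemma least_atom_atom:
  assumes a: "a \<in> atoms n s"
  shows "least_atom n s a = a"
proof -
  have "atom_of (atom_entry a) \<in> atoms n s"
    using atom_of_sorted_labels_le(1)[OF atomD(1)[OF a] sorted_labels_atom[OF a]] .
  then have "atom_of (atom_entry a) = a"
    using atom_eqI[OF _ a] atom_entry_atom_of by blast
  then show ?thesis using least_atom_eq[OF atomD(1)[OF a] sorted_labels_atom[OF a]] by simp
qed

text \<open>The entry of \<open>x\<close> at k lies in the label of the part of \<open>y\<close>
  containing k, and \<open>y\<close> lists this label in increasing order. Agreement before k is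
  asked of row i alone, so each row can be treated separately.\<close>

lemma entry_le_at_first_change:
  assumes x: "x \<in> V" and y: "y \<in> V" and le: "vp_le s x y" and i: "i \<in> {1..s}" and k: "k \<in> {1..n}"
    and agree: "\<And>k'. k' \<in> {1..n} \<Longrightarrow> k' < k \<Longrightarrow> entry n s x i k' = entry n s y i k'"
  shows "entry n s y i k \<le> entry n s x i k"
proof -
  obtain B where B: "B \<in> parts x" "k \<in> B" using part_exists[OF x k] by blast
  obtain C where C: "C \<in> parts y" "k \<in> C" using part_exists[OF y k] by blast
  have Cn: "C \<subseteq> {1..n}" using part_subset[OF y C(1)] .
  show ?thesis
  proof (rule strict_mono_on_le_at_first_deviation[where C = C and g = "entry n s y i"])
    show "strict_mono_on C (entry n s y i)" using entry_strict_mono_on[OF y i C(1)] .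
    show "inj_on (entry n s x i) C"
      using entry_bij[OF x i] Cn by (meson bij_betw_imp_inj_on inj_on_subset)
    have "plabel x i B \<subseteq> plabel y i C"
      using vp_leD(2)[OF x y le B(1) C(1) _ i] B C by blast
    then show "entry n s x i k \<in> entry n s y i ` C"
      using entry_image[OF x i B(1)] entry_image[OF y i C(1)] B(2) by blast
  qed (use C Cn agree in auto)
qed

text \<open>Induction on k: once \<open>z\<close> agrees with \<open>y\<close> before k, its entry
  at k is squeezed between the entries of \<open>y\<close> and \<open>x\<close>, which
  coincide.\<close>

lemma entry_sandwich:
  assumes x: "x \<in> V" and z: "z \<in> V" and y: "y \<in> V" and le: "vp_le s x z" "vp_le s z y"
    and i: "i \<in> {1..s}" and k: "k \<in> {1..n}"
    and agree: "\<And>k'. k' \<in> {1..n} \<Longrightarrow> k' \<le> k \<Longrightarrow> entry n s x i k' = entry n s y i k'"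
  shows "entry n s z i k = entry n s y i k"
  using k agree
proof (induction k rule: less_induct)
  case (less k)
  have IH: "entry n s z i k' = entry n s y i k'" if "k' \<in> {1..n}" "k' < k" for k'
    using less.IH[OF that(2,1)] less.prems(2) that(2) by simp
  have "entry n s y i k \<le> entry n s z i k"
    using IH by (intro entry_le_at_first_change[OF z y le(2) i less.prems(1)])
  moreover have "entry n s z i k \<le> entry n s x i k"
    using IH less.prems by (intro entry_le_at_first_change[OF x z le(1) i less.prems(1)]) simp
  ultimately show ?case using less.prems by simp
qed

section \<open>Covering relations\<close>

definition merge :: "vpart \<Rightarrow> nat set \<Rightarrow> nat set \<Rightarrow> vpart" where
  "merge x I J = (let P = insert (I \<union> J) (parts x - {I, J}) in
     VP P (\<lambda>i\<in>{1..s}. \<lambda>B\<in>P. if B = I \<union> J then plabel x i I \<union> plabel x i J else plabel x i B))"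

lemma merge_commute: "merge x I J = merge x J I"
  by (simp only: merge_def Un_commute[of J I] insert_commute[of J I] Un_commute[of "plabel x _ J"])

lemma parts_merge: "parts (merge x I J) = insert (I \<union> J) (parts x - {I, J})"
  by (simp add: merge_def Let_def)

lemma plabel_merge_Un:
  "i \<in> {1..s} \<Longrightarrow> plabel (merge x I J) i (I \<union> J) = plabel x i I \<union> plabel x i J"
  by (simp add: merge_def Let_def)

text \<open>This keeps the test for the new part in \<open>merge\<close> from catching an old part,
  and it shows that merging really changes the element.\<close>

lemma Un_parts_notin:
  assumes x: "x \<in> V" and IJ: "I \<in> parts x" "J \<in> parts x" "I \<noteq> J"
  shows "I \<union> J \<notin> parts x"
proof
  assume U: "I \<union> J \<in> parts x"
  obtain k l where "k \<in> I" "l \<in> J" using part_nonempty[OF x] IJ by blast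
  then have "I = I \<union> J" "J = I \<union> J"
    using part_unique[OF x IJ(1) U] part_unique[OF x IJ(2) U] by blast+
  then show False using IJ(3) by simp
qed

lemma plabel_merge_other:
  assumes x: "x \<in> V" and IJ: "I \<in> parts x" "J \<in> parts x" "I \<noteq> J"
    and "i \<in> {1..s}" "B \<in> parts x - {I, J}"
  shows "plabel (merge x I J) i B = plabel x i B"
proof -
  have "B \<noteq> I \<union> J" using Un_parts_notin[OF x IJ] assms(6) by blast
  then show ?thesis using assms(5,6) by (simp add: merge_def Let_def)
qed

lemma merge_in_V:
  assumes x: "x \<in> V" and IJ: "I \<in> parts x" "J \<in> parts x" "I \<noteq> J"
  shows "merge x I J \<in> V"
proof -
  let ?z = "merge x I J"
  have lab: "plabel ?z i (I \<union> J) = plabel x i I \<union> plabel x i J"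
    "\<And>B. B \<in> parts x - {I, J} \<Longrightarrow> plabel ?z i B = plabel x i B" if "i \<in> {1..s}" for i
    using plabel_merge_Un plabel_merge_other[OF x IJ] that by auto
  have disj: "plabel x i B \<inter> plabel x i C = {}"
    if "i \<in> {1..s}" "B \<in> parts x" "C \<in> parts x" "B \<noteq> C" for i B C
    using label_unique[OF x that(1-3)] that(4) by auto
  have "VP (parts ?z) (plabel ?z) \<in> V"
  proof (rule vector_partitionI)
    show "partition_on {1..n} (parts ?z)"
      unfolding parts_merge by (rule partition_on_merge[OF vector_partitionD(1)[OF x] IJ(1,2)])
    show "plabel ?z i = undefined" if "i \<notin> {1..s}" for i
      using that by (auto simp: merge_def Let_def)
    show "plabel ?z i B = undefined" if "i \<in> {1..s}" "B \<notin> parts ?z" for i B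
      using that unfolding parts_merge by (auto simp: merge_def Let_def)
    show "card (plabel ?z i B) = card B" if i: "i \<in> {1..s}" and B: "B \<in> parts ?z" for i B
    proof (cases "B = I \<union> J")
      case True
      have "I \<inter> J = {}" using part_unique[OF x IJ(1,2)] IJ(3) by auto
      moreover have "card (plabel x i I \<union> plabel x i J) = card (plabel x i I) + card (plabel x i J)"
        using disj[OF i IJ] finite_label[OF x i] IJ by (intro card_Un_disjoint) auto
      ultimately show ?thesis
        using True lab[OF i] vector_partitionD(4)[OF x i] IJ card_Un_disjoint[of I J] finite_part[OF x]
        by simp
    next
      case False
      then show ?thesis using B lab(2)[OF i] vector_partitionD(4)[OF x i] by (simp add: parts_merge)
    qed
    fix i assume i: "i \<in> {1..s}"
    have "(\<Union>B\<in>parts ?z. plabel ?z i B) = (\<Union>B\<in>parts x. plabel x i B)"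
      using lab[OF i] IJ by (auto simp: parts_merge)
    then show "(\<Union>B\<in>parts ?z. plabel ?z i B) = {1..n}"
      using partition_onD1[OF vector_partitionD(3)[OF x i]] by simp
    have new: "plabel ?z i (I \<union> J) \<inter> plabel ?z i C = {}" if C: "C \<in> parts x - {I, J}" for C
    proof -
      have "plabel x i I \<inter> plabel x i C = {}" "plabel x i J \<inter> plabel x i C = {}"
        using C IJ by (intro disj[OF i]; blast)+
      then show ?thesis using lab(1)[OF i] lab(2)[OF i C] by blast
    qed
    have old: "plabel ?z i B \<inter> plabel ?z i C = {}"
      if "B \<in> parts x - {I, J}" "C \<in> parts x - {I, J}" "B \<noteq> C" for B C
      using lab(2)[OF i that(1)] lab(2)[OF i that(2)] disj[OF i, of B C] that by simp
    show "plabel ?z i B \<inter> plabel ?z i C = {}"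
      if "B \<in> parts ?z" "C \<in> parts ?z" "B \<noteq> C" for B C
      using that new[of B] new[of C] old[of B C] unfolding parts_merge by (metis Int_commute insertE)
  qed
  then show ?thesis by (simp add: merge_def Let_def)
qed

text \<open>Together with \<open>le_merge\<close> this makes the merge the least element above
  \<open>x\<close> that has I and J in one part; covers are recognised through this
  property.\<close>

lemma merge_le:
  assumes x: "x \<in> V" and IJ: "I \<in> parts x" "J \<in> parts x" "I \<noteq> J"
    and y: "y \<in> V" and le: "vp_le s x y" and C: "C \<in> parts y" "I \<subseteq> C" "J \<subseteq> C"
  shows "vp_le s (merge x I J) y"
  unfolding vp_le_iff[OF merge_in_V[OF x IJ] y]
proof
  have sub: "plabel x i B \<subseteq> plabel y i C" if i: "i \<in> {1..s}" and B: "B \<in> {I, J}" for i B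
  proof -
    obtain k where "k \<in> B" using part_nonempty[OF x] IJ B by blast
    then show ?thesis using vp_leD(2)[OF x y le _ C(1) _ i, of B k] B IJ C by blast
  qed
  fix B assume B: "B \<in> parts (merge x I J)"
  show "\<exists>C\<in>parts y. B \<subseteq> C \<and> (\<forall>i\<in>{1..s}. plabel (merge x I J) i B \<subseteq> plabel y i C)"
  proof (cases "B = I \<union> J")
    case True
    have "plabel (merge x I J) i B \<subseteq> plabel y i C" if "i \<in> {1..s}" for i
      using sub[OF that] plabel_merge_Un[OF that] True by simp
    then show ?thesis using C True by blast
  next
    case False
    then have "B \<in> parts x - {I, J}" using B by (simp add: parts_merge)
    then show ?thesis
      using le plabel_merge_other[OF x IJ] unfolding vp_le_iff[OF x y] by auto
  qed
qed

lemma le_merge: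
  assumes x: "x \<in> V" and IJ: "I \<in> parts x" "J \<in> parts x" "I \<noteq> J"
  shows "vp_le s x (merge x I J)"
  unfolding vp_le_iff[OF x merge_in_V[OF x IJ]]
proof
  fix B assume B: "B \<in> parts x"
  show "\<exists>C\<in>parts (merge x I J). B \<subseteq> C \<and> (\<forall>i\<in>{1..s}. plabel x i B \<subseteq> plabel (merge x I J) i C)"
  proof (cases "B \<in> {I, J}")
    case True
    then show ?thesis
      using plabel_merge_Un by (intro bexI[of _ "I \<union> J"]) (auto simp: parts_merge)
  next
    case False
    then show ?thesis
      using plabel_merge_other[OF x IJ] B by (intro bexI[of _ B]) (auto simp: parts_merge)
  qed
qed

lemma merge_neq:
  assumes x: "x \<in> V" and IJ: "I \<in> parts x" "J \<in> parts x" "I \<noteq> J"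
  shows "merge x I J \<noteq> x"
  using Un_parts_notin[OF assms] parts_merge by (metis insertI1)

text \<open>Otherwise every part of \<open>y\<close> would contain just one part of \<open>x\<close>
  and coincide with it, labels included, so that y <= x and x = y.\<close>

lemma ex_two_parts_in_part:
  assumes x: "x \<in> V" and y: "y \<in> V" and le: "vp_le s x y" and ne: "x \<noteq> y"
  shows "\<exists>I J C. I \<in> parts x \<and> J \<in> parts x \<and> I \<noteq> J \<and> C \<in> parts y \<and> I \<subseteq> C \<and> J \<subseteq> C"
proof (rule ccontr)
  assume no: "\<not> ?thesis"
  have "vp_le s y x"
    unfolding vp_le_iff[OF y x]
  proof
    fix C assume C: "C \<in> parts y"
    obtain k where k: "k \<in> C" using part_nonempty[OF y C] by blast
    then obtain B where B: "B \<in> parts x" "k \<in> B"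
      using part_exists[OF x] part_subset[OF y C] by blast
    have BC: "B \<subseteq> C" using vp_leD(1)[OF x y le B(1) C] B(2) k by blast
    have "l \<in> B" if l: "l \<in> C" for l
    proof -
      obtain D where D: "D \<in> parts x" "l \<in> D"
        using part_exists[OF x] part_subset[OF y C] l by blast
      have "D \<subseteq> C" using vp_leD(1)[OF x y le D(1) C] D(2) l by blast
      then show ?thesis using no B(1) BC D C by blast
    qed
    moreover have "j \<in> plabel x i B" if i: "i \<in> {1..s}" and j: "j \<in> plabel y i C" for i j
    proof -
      have "j \<in> {1..n}" using label_subset[OF y i C] j by (rule subsetD)
      then obtain D where D: "D \<in> parts x" "j \<in> plabel x i D"
        using label_exists[OF x i] by blast
      have "D \<subseteq> C" using vp_leD(1)[OF x y le D(1) C] D(2) i j by blast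
      then have "D = B" using no B(1) BC D(1) C by blast
      then show ?thesis using D(2) by simp
    qed
    ultimately show "\<exists>B\<in>parts x. C \<subseteq> B \<and> (\<forall>i\<in>{1..s}. plabel y i C \<subseteq> plabel x i B)"
      using B(1) by blast
  qed
  then show False using vp_le_antisym_V[OF x y le] ne by simp
qed

section \<open>The covers of an element other than \<open>Bot\<close> are the merges of two of its
  parts\<close>

lemma covers_in_V:
  assumes "covers (vector_partitions n s) (vp_le s) x z" "x \<noteq> Bot"
  shows "x \<in> V" "z \<in> V" "vp_le s x z" "x \<noteq> z"
  using coversD[OF assms(1)] assms(2) vp_le_Bot_iff by auto

lemma covers_imp_merge:
  assumes cov: "covers (vector_partitions n s) (vp_le s) x z" and "x \<noteq> Bot"
  shows "\<exists>I J. I \<in> parts x \<and> J \<in> parts x \<and> I \<noteq> J \<and> z = merge x I J"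
proof -
  note xz = covers_in_V[OF assms]
  obtain I J C where IJ: "I \<in> parts x" "J \<in> parts x" "I \<noteq> J" and C: "C \<in> parts z" "I \<subseteq> C" "J \<subseteq> C"
    using ex_two_parts_in_part[OF xz] by blast
  have "merge x I J = z"
    using cov merge_le[OF xz(1) IJ xz(2,3) C] le_merge[OF xz(1) IJ] merge_neq[OF xz(1) IJ]
      merge_in_V[OF xz(1) IJ] unfolding covers_def by blast
  then show ?thesis using IJ by blast
qed

text \<open>An element strictly above \<open>x\<close> and below the merge has a part containing two
  parts of \<open>x\<close>. These can only be I and J, so by \<open>merge_le\<close> the element is
  already the merge.\<close>

lemma covers_merge:
  assumes x: "x \<in> V" and IJ: "I \<in> parts x" "J \<in> parts x" "I \<noteq> J"
  shows "covers (vector_partitions n s) (vp_le s) x (merge x I J)"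
  unfolding covers_def
proof (intro conjI ballI impI)
  let ?z = "merge x I J"
  show "x \<in> vector_partitions n s" "?z \<in> vector_partitions n s" "vp_le s x ?z" "x \<noteq> ?z"
    using x merge_in_V[OF assms] le_merge[OF assms] merge_neq[OF assms] by auto
  fix v assume v: "v \<in> vector_partitions n s" "vp_le s x v \<and> vp_le s v ?z"
  then have vV: "v \<in> V" using x vp_le_Bot_iff by auto
  show "v = x \<or> v = ?z"
  proof (rule disjCI)
    assume "v \<noteq> ?z"
    show "v = x"
    proof (rule ccontr)
      assume "v \<noteq> x"
      then obtain K L C where KL: "K \<in> parts x" "L \<in> parts x" "K \<noteq> L"
        and C: "C \<in> parts v" "K \<subseteq> C" "L \<subseteq> C"
        using ex_two_parts_in_part[OF x vV] v(2) by blast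
      obtain D where D: "D \<in> parts ?z" "C \<subseteq> D"
        using v(2) unfolding vp_le_iff[OF vV merge_in_V[OF assms]] using C(1) by blast
      \<comment> \<open>If \<open>D\<close> were an old part, every part of \<open>x\<close> inside
        \<open>C\<close> would be equal to it. The two different parts \<open>K\<close> and
        \<open>L\<close> exclude this, so \<open>D\<close> is the new part.\<close>
      have sub: "B = D" if "D \<in> parts x" "B \<in> parts x" "B \<subseteq> C" for B
        using part_nonempty[OF x that(2)] part_unique[OF x that(2,1)] that(3) D(2) by blast
      have "D \<notin> parts x" using sub KL C by metis
      then have "D = I \<union> J" using D by (simp add: parts_merge)
      have "B \<in> {I, J}" if "B \<in> {K, L}" for B
      proof -
        have "B \<subseteq> I \<union> J" "B \<in> parts x" using that C D \<open>D = I \<union> J\<close> KL by blast+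
        then show ?thesis
          using part_nonempty[OF x, of B] part_unique[OF x _ IJ(1)] part_unique[OF x _ IJ(2)] by blast
      qed
      then have "I \<subseteq> C" "J \<subseteq> C" using C KL(3) by blast+
      then have "vp_le s ?z v" using merge_le[OF assms vV _ C(1)] v(2) by blast
      then show False using vp_le_antisym_V[OF vV merge_in_V[OF assms]] v(2) \<open>v \<noteq> ?z\<close> by blast
    qed
  qed
qed

text \<open>The merged set is the only part of the new element that is not a part of
  \<open>x\<close>, so the description under \<open>THE\<close> determines it.\<close>

lemma merged_part_merge:
  assumes x: "x \<in> V" and IJ: "I \<in> parts x" "J \<in> parts x" "I \<noteq> J"
  shows "merged_part x (merge x I J) = I \<union> J"
  unfolding merged_part_def
proof (rule the_equality)
  show "\<exists>I' J'. I' \<in> parts x \<and> J' \<in> parts x \<and> I' \<noteq> J' \<and> I \<union> J = I' \<union> J' \<and>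
      parts (merge x I J) = insert (I \<union> J) (parts x - {I', J'})"
    using IJ parts_merge by blast
  fix M assume "\<exists>I' J'. I' \<in> parts x \<and> J' \<in> parts x \<and> I' \<noteq> J' \<and> M = I' \<union> J' \<and>
      parts (merge x I J) = insert M (parts x - {I', J'})"
  then obtain I' J' where "I' \<in> parts x" "J' \<in> parts x" "I' \<noteq> J'" "M = I' \<union> J'"
      "parts (merge x I J) = insert M (parts x - {I', J'})" by blast
  moreover from this have "M \<notin> parts x" using Un_parts_notin[OF x] by blast
  ultimately show "M = I \<union> J" using parts_merge[of x I J] by blast
qed

section \<open>The covers of \<open>Bot\<close> are the atoms\<close>

lemma covers_Bot_imp_atom:
  assumes "covers (vector_partitions n s) (vp_le s) Bot a"
  shows "a \<in> atoms n s"
proof -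
  have a: "a \<in> V" using coversD[OF assms] by auto
  have "least_atom n s a \<in> vector_partitions n s" "least_atom n s a \<noteq> Bot"
    using atomD(1)[OF least_atom(1)[OF a]] by auto
  then have "least_atom n s a = a"
    using assms least_atom(2)[OF a] unfolding covers_def by auto
  then show ?thesis using least_atom(1)[OF a] by simp
qed

lemma covers_Bot_if_atom:
  assumes a: "a \<in> atoms n s"
  shows "covers (vector_partitions n s) (vp_le s) Bot a"
proof -
  have "v = a" if v: "v \<in> V" "vp_le s v a" for v
  proof -
    have "k = l" if "k \<in> B" "l \<in> B" "B \<in> parts a" for k l B
      using that atomD(2)[OF a] by auto
    moreover have "\<exists>k. k \<in> B" if "B \<in> parts v" for B using part_nonempty[OF v(1) that] by blast
    \<comment> \<open>Two nonempty parts inside a singleton share its element and are therefore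
      equal.\<close>
    ultimately have no: "\<not> (\<exists>I J C. I \<in> parts v \<and> J \<in> parts v \<and> I \<noteq> J \<and> C \<in> parts a \<and> I \<subseteq> C \<and> J \<subseteq> C)"
      using part_unique[OF v(1)] by (metis in_mono)
    then show ?thesis using ex_two_parts_in_part[OF v(1) atomD(1)[OF a] v(2)] by blast
  qed
  then show ?thesis using atomD(1)[OF a] by (auto simp: covers_def vector_partitions_def)
qed

section \<open>The greedy step\<close>

lemma entry_in_label:
  "\<lbrakk>x \<in> V; i \<in> {1..s}; B \<in> parts x; k \<in> B\<rbrakk> \<Longrightarrow> entry n s x i k \<in> plabel x i B"
  using entry_image[of x i B] by (metis imageI)

abbreviation cov :: "vpart \<Rightarrow> vpart \<Rightarrow> bool" where
  "cov \<equiv> covers (vector_partitions n s) (vp_le s)"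

section \<open>Agreement of entries before a position, positions being ordered by k first and then
  by i\<close>

definition agree_below :: "vpart \<Rightarrow> vpart \<Rightarrow> nat \<times> nat \<Rightarrow> bool" where
  "agree_below x y p \<longleftrightarrow>
    (\<forall>k\<in>{1..n}. \<forall>i\<in>{1..s}. (k, i) < p \<longrightarrow> entry n s x i k = entry n s y i k)"

lemma agree_belowD:
  "\<lbrakk>agree_below x y p; k \<in> {1..n}; i \<in> {1..s}; (k, i) < p\<rbrakk> \<Longrightarrow> entry n s x i k = entry n s y i k"
  by (simp add: agree_below_def)

lemma agree_below_sym: "agree_below x y p \<Longrightarrow> agree_below y x p"
  by (simp add: agree_below_def)

lemma agree_below_trans: "agree_below x y p \<Longrightarrow> agree_below y z p \<Longrightarrow> agree_below x z p"
  by (simp add: agree_below_def)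

lemma agree_below_mono: "agree_below x y p \<Longrightarrow> q \<le> p \<Longrightarrow> agree_below x y q"
  by (meson agree_below_def order_less_le_trans)

text \<open>The bound \<open>(k, Suc i)\<close> expresses agreement up to and including (k, i). For
  i = s it is not a position itself but still a valid bound.\<close>

lemma agree_below_Suc:
  assumes "k \<in> {1..n}" "i \<in> {1..s}"
  shows "agree_below x y (k, Suc i) \<longleftrightarrow>
    agree_below x y (k, i) \<and> entry n s x i k = entry n s y i k" (is "?L \<longleftrightarrow> ?R")
proof
  show ?R if ?L
    using agree_belowD[OF that assms] agree_below_mono[OF that, of "(k, i)"] by simp
  show ?L if R: ?R
    unfolding agree_below_def
  proof (intro ballI impI)
    fix k' i' assume ki': "k' \<in> {1..n}" "i' \<in> {1..s}" "(k', i') < (k, Suc i)"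
    then have "(k', i') < (k, i) \<or> k' = k \<and> i' = i" by auto
    then show "entry n s x i' k' = entry n s y i' k'" using R agree_belowD ki'(1,2) by blast
  qed
qed

text \<open>Since (k', i) <= (k, i) for k' <= k, an initial segment of the positions meets every row
  in an initial segment, so the squeeze within a single row applies.\<close>

lemma agree_below_sandwich:
  assumes "x \<in> V" "z \<in> V" "y \<in> V" "vp_le s x z" "vp_le s z y" and agree: "agree_below x y p"
  shows "agree_below z y p"
  unfolding agree_below_def
proof (intro ballI impI)
  fix k i assume ki: "k \<in> {1..n}" "i \<in> {1..s}" "(k, i) < p"
  show "entry n s z i k = entry n s y i k"
  proof (rule entry_sandwich[OF assms(1-5) ki(2,1)])
    fix k' assume k': "k' \<in> {1..n}" "k' \<le> k"
    have "(k', i) \<le> (k, i)" using k'(2) by auto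
    then show "entry n s x i k' = entry n s y i k'"
      using agree_belowD[OF agree k'(1) ki(2)] ki(3) by (meson order_le_less_trans)
  qed
qed

lemma least_atom_sandwich:
  assumes "x \<in> V" "z \<in> V" "y \<in> V" "vp_le s x z" "vp_le s z y"
    and eq: "least_atom n s x = least_atom n s y"
  shows "least_atom n s z = least_atom n s y"
proof -
  have ent: "entry n s x i k = entry n s y i k" for i k using eq by (simp add: entry_def)
  then show ?thesis
    unfolding least_atom_eq_iff[OF assms(2,3)]
    using entry_sandwich[OF assms(1-5)] by blast
qed

section \<open>The first change between two elements and the edge label it determines\<close>

definition first_change_at :: "vpart \<Rightarrow> vpart \<Rightarrow> nat \<Rightarrow> nat \<Rightarrow> bool" where
  "first_change_at x y k i \<longleftrightarrow> k \<in> {1..n} \<and> i \<in> {1..s} \<and> agree_below x y (k, i) \<and>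
    entry n s x i k \<noteq> entry n s y i k"

lemma first_change_atD:
  assumes "first_change_at x y k i"
  shows "k \<in> {1..n}" "i \<in> {1..s}" "agree_below x y (k, i)" "entry n s x i k \<noteq> entry n s y i k"
  using assms by (simp_all add: first_change_at_def)

lemma first_change_at_exists:
  assumes "x \<in> V" "y \<in> V" "least_atom n s x \<noteq> least_atom n s y"
  shows "\<exists>k i. first_change_at x y k i"
proof -
  let ?P = "\<lambda>p. case p of (k, i) \<Rightarrow>
    k \<in> {1..n} \<and> i \<in> {1..s} \<and> entry n s x i k \<noteq> entry n s y i k"
  obtain i k where ik: "i \<in> {1..s}" "k \<in> {1..n}" "entry n s x i k \<noteq> entry n s y i k"
    using assms(3) unfolding least_atom_eq_iff[OF assms(1,2)] by blast
  define q where "q = Least ?P"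
  have "?P (k, i)" using ik by simp
  then have q: "?P q" unfolding q_def by (rule LeastI)
  have q_least: "\<not> ?P r" if "r < q" for r using that unfolding q_def by (rule not_less_Least)
  obtain k i where ki: "q = (k, i)" by fastforce
  have "agree_below x y (k, i)"
    using q_least unfolding ki agree_below_def by blast
  then have "first_change_at x y k i" using q by (simp add: ki first_change_at_def)
  then show ?thesis by blast
qed

lemma edge_label_first_change:
  assumes "x \<in> V" "first_change_at x y k i"
  shows "edge_label n s x y = (int k, int i, int (entry n s y i k))"
proof -
  note fc = first_change_atD[OF assms(2)]
  have "first_change n s x y = (k, i)"
    unfolding first_change_def
  proof (rule Least_equality)
    show "case (k, i) of (k, i) \<Rightarrow> k \<in> {1..n} \<and> i \<in> {1..s} \<and> entry n s x i k \<noteq> entry n s y i k"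
      using fc by simp
    fix q assume q: "case q of (k, i) \<Rightarrow> k \<in> {1..n} \<and> i \<in> {1..s} \<and> entry n s x i k \<noteq> entry n s y i k"
    obtain k' i' where ki': "q = (k', i')" by fastforce
    then have "\<not> (k', i') < (k, i)" using agree_belowD[OF fc(3), of k' i'] q by auto
    then show "(k, i) \<le> q" using ki' by (simp only: not_less)
  qed
  moreover have "least_atom n s x \<noteq> least_atom n s y"
    using fc(4) by (auto simp: entry_def)
  moreover have "x \<noteq> Bot" using assms(1) by simp
  ultimately show ?thesis by (simp add: edge_label_def)
qed

lemma edge_label_const:
  "\<lbrakk>x \<in> V; least_atom n s x = least_atom n s y\<rbrakk> \<Longrightarrow>
    edge_label n s x y = (int n, int (Max (merged_part x y)), 0)"
  by (simp add: edge_label_def)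

section \<open>Intervals on which the least atom changes\<close>

lemma first_change_at_merge:
  assumes x: "x \<in> V" and y: "y \<in> V" and le: "vp_le s x y" and fc: "first_change_at x y k i"
  shows "k < n"
    and "\<exists>I J C. I \<in> parts x \<and> J \<in> parts x \<and> I \<noteq> J \<and> C \<in> parts y \<and> I \<subseteq> C \<and> J \<subseteq> C \<and>
      k \<in> I \<and> entry n s y i k \<in> plabel x i J"
proof -
  note fc = first_change_atD[OF fc]
  let ?j = "entry n s y i k"
  have "?j \<in> {1..n}" using entry_bij[OF y fc(2)] fc(1) bij_betwE by blast
  \<comment> \<open>The position at which row i of \<open>x\<close> carries the value that
    \<open>y\<close> has at k. It cannot precede k: by agreement \<open>y\<close> would carry this
    value at both positions.\<close>
  then obtain m where m: "m \<in> {1..n}" "entry n s x i m = ?j"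
    using entry_bij[OF x fc(2)] unfolding bij_betw_def by (metis imageE)
  have "\<not> m < k"
  proof
    assume "m < k"
    then have "entry n s y i m = ?j" using agree_belowD[OF fc(3) m(1) fc(2)] m(2) by simp
    then show False using entry_inj[OF y fc(2) m(1) fc(1)] \<open>m < k\<close> by simp
  qed
  moreover have "m \<noteq> k" using m(2) fc(4) by auto
  ultimately have mk: "k < m" by simp
  \<comment> \<open>This strict bound puts labels coming from a change of the least atom below the
    labels of constant steps, which start with n.\<close>
  then show "k < n" using m(1) by simp
  have le_k: "?j \<le> entry n s x i k"
    using agree_belowD[OF fc(3) _ fc(2)] by (intro entry_le_at_first_change[OF x y le fc(2,1)]) simp
  obtain I where I: "I \<in> parts x" "k \<in> I" using part_exists[OF x fc(1)] by blast
  obtain J where J: "J \<in> parts x" "m \<in> J" using part_exists[OF x m(1)] by blast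
  have jJ: "?j \<in> plabel x i J" using entry_in_label[OF x fc(2) J] m(2) by simp
  \<comment> \<open>On a part of \<open>x\<close> entries increase, but the entry at m > k is at
    most the entry at k; so k and m lie in different parts.\<close>
  have "I \<noteq> J"
  proof
    assume "I = J"
    then have "entry n s x i k < entry n s x i m"
      using entry_strict_mono_on[OF x fc(2) J(1)] I J mk by (simp add: strict_mono_on_def)
    then show False using le_k m(2) by simp
  qed
  moreover obtain C where C: "C \<in> parts y" "k \<in> C" using part_exists[OF y fc(1)] by blast
  moreover have "I \<subseteq> C" using vp_leD(1)[OF x y le I(1) C(1)] I(2) C(2) by blast
  moreover have "J \<subseteq> C"
    using vp_leD(1)[OF x y le J(1) C(1)] jJ entry_in_label[OF y fc(2) C] fc(2) by blast
  ultimately show "\<exists>I J C. I \<in> parts x \<and> J \<in> parts x \<and> I \<noteq> J \<and> C \<in> parts y \<and> I \<subseteq> C \<and> J \<subseteq> C \<and>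
      k \<in> I \<and> ?j \<in> plabel x i J"
    using I J jJ by blast
qed

text \<open>In the merged part the value w of \<open>y\<close> at (k, i) occurs at some m, and m < k
  is excluded by agreement with \<open>y\<close>. So the entry at k is at most w because entries
  increase on the part, and at least w because the merge is below \<open>y\<close>. Conversely, a
  cover with entry w at k has I and J in the part containing k; it lies above the merge and equals
  it.\<close>

lemma ex_unique_agreeing_cover:
  assumes x: "x \<in> V" and y: "y \<in> V" and le: "vp_le s x y" and fc: "first_change_at x y k i"
  shows "\<exists>z. cov x z \<and> vp_le s z y \<and> agree_below z y (k, Suc i) \<and>
    edge_label n s x z = (int k, int i, int (entry n s y i k)) \<and>
    (\<forall>z'. cov x z' \<and> vp_le s z' y \<and> agree_below z' y (k, Suc i) \<longrightarrow> z' = z)"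
proof -
  note fcD = first_change_atD[OF fc]
  let ?j = "entry n s y i k"
  obtain I J C where IJ: "I \<in> parts x" "J \<in> parts x" "I \<noteq> J"
    and C: "C \<in> parts y" "I \<subseteq> C" "J \<subseteq> C" and k: "k \<in> I" and j: "?j \<in> plabel x i J"
    using first_change_at_merge(2)[OF x y le fc] by blast
  let ?z = "merge x I J"
  have z: "?z \<in> V" "vp_le s x ?z" "vp_le s ?z y" "cov x ?z"
    using merge_in_V[OF x IJ] le_merge[OF x IJ] merge_le[OF x IJ y le C] covers_merge[OF x IJ] by auto
  have U: "I \<union> J \<in> parts ?z" by (simp add: parts_merge)
  have below: "agree_below ?z y (k, i)" using agree_below_sandwich[OF x z(1) y z(2,3) fcD(3)] .
  have "?j \<in> entry n s ?z i ` (I \<union> J)"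
    using entry_image[OF z(1) fcD(2) U] plabel_merge_Un[OF fcD(2)] j by simp
  then obtain m where m: "m \<in> I \<union> J" "entry n s ?z i m = ?j" by force
  have mn: "m \<in> {1..n}" using part_subset[OF z(1) U] m(1) by (rule subsetD)
  have "\<not> m < k"
  proof
    assume "m < k"
    then have "entry n s y i m = ?j" using agree_belowD[OF below mn fcD(2)] m(2) by simp
    then show False using entry_inj[OF y fcD(2) mn fcD(1)] \<open>m < k\<close> by simp
  qed
  then have "entry n s ?z i k \<le> ?j"
    using strict_mono_on_leD[OF entry_strict_mono_on[OF z(1) fcD(2) U], of k m] k m by simp
  moreover have "?j \<le> entry n s ?z i k"
    using agree_belowD[OF below _ fcD(2)]
    by (intro entry_le_at_first_change[OF z(1) y z(3) fcD(2,1)]) simp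
  ultimately have zk: "entry n s ?z i k = ?j" by simp
  have agree: "agree_below ?z y (k, Suc i)"
    using below zk agree_below_Suc[OF fcD(1,2)] by blast
  have "first_change_at x ?z k i"
    using fcD zk agree_below_trans[OF fcD(3) agree_below_sym[OF below]]
    by (simp add: first_change_at_def)
  then have label: "edge_label n s x ?z = (int k, int i, int ?j)"
    using edge_label_first_change[OF x] zk by simp
  have "z' = ?z" if z': "cov x z'" "vp_le s z' y" "agree_below z' y (k, Suc i)" for z'
  proof -
    have "x \<noteq> Bot" using x by simp
    note z'V = covers_in_V[OF z'(1) this]
    obtain D where D: "D \<in> parts z'" "k \<in> D" using part_exists[OF z'V(2) fcD(1)] by blast
    have "entry n s z' i k = ?j" using z'(3) agree_below_Suc[OF fcD(1,2)] by blast
    then have "?j \<in> plabel z' i D" using entry_in_label[OF z'V(2) fcD(2) D] by simp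
    then have "J \<subseteq> D" using vp_leD(1)[OF z'V(1-3) IJ(2) D(1)] j fcD(2) by blast
    moreover have "I \<subseteq> D" using vp_leD(1)[OF z'V(1-3) IJ(1) D(1)] k D(2) by blast
    ultimately have "vp_le s ?z z'" using merge_le[OF x IJ z'V(2,3) D(1)] by blast
    moreover have "?z \<in> vector_partitions n s" "?z \<noteq> x" using z(1) merge_neq[OF x IJ] by auto
    ultimately show ?thesis using z'(1) z(2) unfolding covers_def by blast
  qed
  then show ?thesis using z agree label by blast
qed

text \<open>If the least atom stays, the label starts with n > k. Otherwise \<open>z\<close> agrees
  with \<open>x\<close> as far as \<open>y\<close> does, which delays the first change of the step
  to a position after (k, i); the third component then has no influence.\<close>

lemma edge_label_gt_if_agree:
  assumes x: "x \<in> V" and z: "cov x z" "vp_le s z y" and y: "y \<in> V"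
    and agree: "agree_below x y (k, Suc i)" and ki: "k \<in> {1..n}" "i \<in> {1..s}" "k < n"
  shows "(int k, int i, j) < edge_label n s x z"
proof -
  have "x \<noteq> Bot" using x by simp
  note zV = covers_in_V[OF z(1) this]
  show ?thesis
  proof (cases "least_atom n s x = least_atom n s z")
    case True
    then show ?thesis using edge_label_const[OF x] ki(3) by simp
  next
    case False
    then obtain k' i' where fc: "first_change_at x z k' i'"
      using first_change_at_exists[OF x zV(2)] by blast
    note fcD = first_change_atD[OF fc]
    have "agree_below x z (k, Suc i)"
      using agree agree_below_sandwich[OF x zV(2) y zV(3) z(2) agree]
      by (blast intro: agree_below_trans agree_below_sym)
    then have "\<not> (k', i') < (k, Suc i)" using agree_belowD[OF _ fcD(1,2)] fcD(4) by blast
    then show ?thesis using edge_label_first_change[OF x fc] by auto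
  qed
qed

text \<open>A cover other than the agreeing one matches \<open>y\<close> before (k, i) but not at
  it. So (k, i) is also the first change from this cover to \<open>y\<close>, and the minimal label
  is available again in the next step.\<close>

lemma greedy_step_if_least_atom_changes:
  assumes x: "x \<in> V" and y: "y \<in> V" and le: "vp_le s x y"
    and ne: "least_atom n s x \<noteq> least_atom n s y"
  shows "\<exists>z. greedy_step (edge_label n s) x y z"
proof -
  obtain k i where fc: "first_change_at x y k i" using first_change_at_exists[OF x y ne] by blast
  note fcD = first_change_atD[OF fc]
  have kn: "k < n" using first_change_at_merge(1)[OF x y le fc] .
  have x0: "x \<noteq> Bot" using x by simp
  let ?l = "(int k, int i, int (entry n s y i k))"
  obtain z where z: "cov x z" "vp_le s z y" "agree_below z y (k, Suc i)" "edge_label n s x z = ?l"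
    and z_unique: "\<And>z'. cov x z' \<Longrightarrow> vp_le s z' y \<Longrightarrow> agree_below z' y (k, Suc i) \<Longrightarrow> z' = z"
    using ex_unique_agreeing_cover[OF x y le fc] by blast
  note zV = covers_in_V[OF z(1) x0]
  have "?l < edge_label n s x z' \<and> (\<exists>v. cov z' v \<and> vp_le s v y \<and> edge_label n s z' v \<le> edge_label n s x z')"
    if z': "cov x z'" "vp_le s z' y" "z' \<noteq> z" for z'
  proof -
    note z'V = covers_in_V[OF z'(1) x0]
    have below: "agree_below z' y (k, i)" using agree_below_sandwich[OF x z'V(2) y z'V(3) z'(2) fcD(3)] .
    have ne': "entry n s z' i k \<noteq> entry n s y i k"
      using z_unique[OF z'(1,2)] z'(3) agree_below_Suc[OF fcD(1,2)] below by blast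
    then have fc': "first_change_at z' y k i" using fcD(1,2) below by (simp add: first_change_at_def)
    have xz': "agree_below x z' (k, i)" using agree_below_trans[OF fcD(3) agree_below_sym[OF below]] .
    have "?l < edge_label n s x z'"
    \<comment> \<open>If \<open>z'\<close> keeps the entry of \<open>x\<close>, its label belongs to
      a later position or to a constant least atom. Otherwise its label belongs to (k, i) but has a
      value above that of \<open>y\<close>.\<close>
    proof (cases "entry n s x i k = entry n s z' i k")
      case True
      then have "agree_below x z' (k, Suc i)" using xz' agree_below_Suc[OF fcD(1,2)] by blast
      \<comment> \<open>Here \<open>z'\<close> itself takes the role of the upper element.\<close>
      then show ?thesis using edge_label_gt_if_agree[OF x z'(1) vp_le_refl_V[OF z'V(2)] z'V(2) _ fcD(1,2) kn]
        by blast
    next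
      case False
      then have "first_change_at x z' k i" using fcD(1,2) xz' by (simp add: first_change_at_def)
      moreover have "entry n s y i k \<le> entry n s z' i k"
        using agree_belowD[OF below _ fcD(2)]
        by (intro entry_le_at_first_change[OF z'V(2) y z'(2) fcD(2,1)]) simp
      ultimately show ?thesis using edge_label_first_change[OF x] ne' by simp
    qed
    moreover obtain v where "cov z' v" "vp_le s v y" "edge_label n s z' v = ?l"
      using ex_unique_agreeing_cover[OF z'V(2) y z'(2) fc'] by blast
    ultimately show ?thesis by (metis order_less_imp_le)
  qed
  moreover have "?l < edge_label n s z v" if "cov z v" "vp_le s v y" for v
    using edge_label_gt_if_agree[OF zV(2) that y z(3) fcD(1,2) kn] .
  ultimately have "greedy_step (edge_label n s) x y z"
    using z unfolding greedy_step_def by auto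
  then show ?thesis by blast
qed

section \<open>Intervals on which the least atom is constant\<close>

definition mergeable :: "vpart \<Rightarrow> vpart \<Rightarrow> nat set \<Rightarrow> nat set \<Rightarrow> bool" where
  "mergeable x y I J \<longleftrightarrow> I \<in> parts x \<and> J \<in> parts x \<and> Max I < Max J \<and>
    (\<exists>C\<in>parts y. I \<subseteq> C \<and> J \<subseteq> C)"

lemma Max_in_part: "x \<in> V \<Longrightarrow> B \<in> parts x \<Longrightarrow> Max B \<in> B"
  using finite_part part_nonempty by simp

lemma Max_part_inj: "\<lbrakk>x \<in> V; I \<in> parts x; J \<in> parts x; Max I = Max J\<rbrakk> \<Longrightarrow> I = J"
  using part_unique Max_in_part by metis

lemma mergeableD:
  assumes "mergeable x y I J"
  shows "I \<in> parts x" "J \<in> parts x" "I \<noteq> J" "Max I < Max J"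
  using assms by (auto simp: mergeable_def)

lemma mergeable_or:
  assumes "x \<in> V" "I \<in> parts x" "J \<in> parts x" "I \<noteq> J" "C \<in> parts y" "I \<subseteq> C" "J \<subseteq> C"
  shows "mergeable x y I J \<or> mergeable x y J I"
proof -
  have "Max I \<noteq> Max J" using Max_part_inj assms(1-4) by blast
  then show ?thesis using assms unfolding mergeable_def by (metis linorder_neqE_nat)
qed

text \<open>Parts of \<open>y\<close> are disjoint, so C is the part of \<open>y\<close> that
  contains both I and J, and K joins them there.\<close>

lemma mergeable_third:
  assumes x: "x \<in> V" and y: "y \<in> V" and IJ: "mergeable x y I J" and K: "K \<in> parts x" "K \<noteq> I"
    and C: "C \<in> parts y" "K \<subseteq> C" "I \<subseteq> C \<or> J \<subseteq> C"
  shows "mergeable x y I K \<or> mergeable x y K I"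
proof -
  obtain D where D: "D \<in> parts y" "I \<subseteq> D" "J \<subseteq> D" using IJ by (auto simp: mergeable_def)
  have "Max I \<in> I" "Max J \<in> J" using Max_in_part[OF x] mergeableD[OF IJ] by blast+
  then have "C = D" using part_unique[OF y C(1) D(1)] C(3) D by blast
  then show ?thesis using mergeable_or[OF x _ K(1) _ C(1)] mergeableD[OF IJ] K C D by blast
qed

lemma covers_merge_mergeable:
  assumes x: "x \<in> V" and y: "y \<in> V" and le: "vp_le s x y" and m: "mergeable x y I J"
  shows "cov x (merge x I J)" "vp_le s (merge x I J) y"
proof -
  note IJ = mergeableD[OF m]
  show "cov x (merge x I J)" using covers_merge[OF x IJ(1-3)] .
  show "vp_le s (merge x I J) y"
    using m merge_le[OF x IJ(1-3) y le] unfolding mergeable_def by blast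
qed

lemma covers_imp_mergeable:
  assumes x: "x \<in> V" and y: "y \<in> V" and z: "cov x z" "vp_le s z y"
  shows "\<exists>I J. mergeable x y I J \<and> z = merge x I J"
proof -
  have "x \<noteq> Bot" using x by simp
  then obtain I J where IJ: "I \<in> parts x" "J \<in> parts x" "I \<noteq> J" and zm: "z = merge x I J"
    using covers_imp_merge[OF z(1)] by blast
  have "I \<union> J \<in> parts z" by (simp add: zm parts_merge)
  then obtain C where "C \<in> parts y" "I \<union> J \<subseteq> C"
    using z(2) unfolding vp_le_iff[OF covers_in_V(2)[OF z(1) \<open>x \<noteq> Bot\<close>] y] by blast
  then have "mergeable x y I J \<or> mergeable x y J I" using mergeable_or[OF x IJ] by blast
  then show ?thesis using zm merge_commute by metis
qed

text \<open>This is the purpose of ordering a mergeable pair by maxima: the second member alone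
  determines the edge label.\<close>

lemma Max_Un_mergeable:
  assumes x: "x \<in> V" and m: "mergeable x y I J"
  shows "Max (I \<union> J) = Max J"
  using mergeableD[OF m] finite_part[OF x] part_nonempty[OF x] by (simp add: Max_Un)

lemma edge_label_merge:
  assumes x: "x \<in> V" and y: "y \<in> V" and le: "vp_le s x y"
    and eq: "least_atom n s x = least_atom n s y" and m: "mergeable x y I J"
  shows "edge_label n s x (merge x I J) = (int n, int (Max J), 0)"
    and "least_atom n s (merge x I J) = least_atom n s y"
proof -
  note IJ = mergeableD[OF m]
  show "least_atom n s (merge x I J) = least_atom n s y"
    using least_atom_sandwich[OF x merge_in_V[OF x IJ(1-3)] y le_merge[OF x IJ(1-3)]
      covers_merge_mergeable(2)[OF x y le m] eq] .
  then show "edge_label n s x (merge x I J) = (int n, int (Max J), 0)"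
    using edge_label_const[OF x] eq merged_part_merge[OF x IJ(1-3)] Max_Un_mergeable[OF x m] by simp
qed

lemma greedy_step_if_least_atom_constant:
  assumes x: "x \<in> V" and y: "y \<in> V" and le: "vp_le s x y" and ne: "x \<noteq> y"
    and eq: "least_atom n s x = least_atom n s y"
  shows "\<exists>z. greedy_step (edge_label n s) x y z"
proof -
  obtain I0 J0 where m0: "mergeable x y I0 J0"
    and min: "\<And>I J. mergeable x y I J \<Longrightarrow> Max J0 \<le> Max J"
  proof -
    define P where "P m \<longleftrightarrow> (\<exists>I J. mergeable x y I J \<and> m = Max J)" for m
    obtain I J C where "I \<in> parts x" "J \<in> parts x" "I \<noteq> J" "C \<in> parts y" "I \<subseteq> C" "J \<subseteq> C"
      using ex_two_parts_in_part[OF x y le ne] by blast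
    then have "\<exists>m. P m" using mergeable_or[OF x] unfolding P_def by blast
    then have "P (LEAST m. P m)" by (rule LeastI_ex)
    moreover have "(LEAST m. P m) \<le> Max J" if "mergeable x y I J" for I J
      using that by (intro Least_le) (auto simp: P_def)
    ultimately show thesis using that unfolding P_def by metis
  qed
  note IJ0 = mergeableD[OF m0]
  let ?z = "merge x I0 J0"
  have zV: "?z \<in> V" using merge_in_V[OF x IJ0(1-3)] .
  have z: "cov x ?z" "vp_le s ?z y" using covers_merge_mergeable[OF x y le m0] .
  have zlab: "edge_label n s x ?z = (int n, int (Max J0), 0)"
    and zeq: "least_atom n s ?z = least_atom n s y"
    using edge_label_merge[OF x y le eq m0] .
  \<comment> \<open>Inside their part of \<open>y\<close>, I0 and J0 are thus the parts of
    \<open>x\<close> with the two smallest maxima.\<close>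
  have third: "Max J0 \<le> Max K"
    if "K \<in> parts x" "K \<noteq> I0" "C \<in> parts y" "K \<subseteq> C" "I0 \<subseteq> C \<or> J0 \<subseteq> C" for K C
    using mergeable_third[OF x y m0 that] min[of I0 K] min[of K I0] IJ0(4) by fastforce
  have after: "edge_label n s x ?z < edge_label n s ?z v" if v: "cov ?z v" "vp_le s v y" for v
  proof -
    obtain K L where m: "mergeable ?z y K L" and v_eq: "v = merge ?z K L"
      using covers_imp_mergeable[OF zV y v] by blast
    note KL = mergeableD[OF m]
    obtain C where C: "C \<in> parts y" "K \<subseteq> C" "L \<subseteq> C" using m by (auto simp: mergeable_def)
    have Max0: "Max (I0 \<union> J0) = Max J0" using Max_Un_mergeable[OF x m0] .
    \<comment> \<open>Suppose not; then K is an old part. If L is the merged part, K is too small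
      for \<open>third\<close>. If L is old, the pair was mergeable in \<open>x\<close>, so
      minimality gives Max L = Max J0 and L = J0, a part that has been merged away.\<close>
    have "Max J0 < Max L"
    proof (rule ccontr)
      assume "\<not> Max J0 < Max L"
      then have small: "Max L \<le> Max J0" "Max K < Max J0" using KL(4) by auto
      then have K: "K \<in> parts x" "K \<noteq> I0" "K \<noteq> J0"
        using KL(1) Max0 unfolding parts_merge by auto
      show False
      proof (cases "L = I0 \<union> J0")
        case True
        then show ?thesis using third[OF K(1,2) C(1,2)] C(3) small(2) by auto
      next
        case False
        then have L: "L \<in> parts x" "L \<noteq> J0" using KL(2) unfolding parts_merge by auto
        then have "mergeable x y K L" using K(1) KL(4) C by (auto simp: mergeable_def)
        then have "Max J0 = Max L" using min[of K L] small(1) by simp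
        then show ?thesis using Max_part_inj[OF x IJ0(2) L(1)] L(2) by simp
      qed
    qed
    then show ?thesis using edge_label_merge(1)[OF zV y z(2) zeq m] zlab v_eq by simp
  qed
  have others: "edge_label n s x ?z < edge_label n s x z' \<and>
      (\<exists>v. cov z' v \<and> vp_le s v y \<and> edge_label n s z' v \<le> edge_label n s x z')"
    if z': "cov x z'" "vp_le s z' y" "z' \<noteq> ?z" for z'
  proof -
    obtain I J where m: "mergeable x y I J" and z'_eq: "z' = merge x I J"
      using covers_imp_mergeable[OF x y z'(1,2)] by blast
    note IJ = mergeableD[OF m]
    obtain C where C: "C \<in> parts y" "I \<subseteq> C" "J \<subseteq> C" using m by (auto simp: mergeable_def)
    have z'V: "z' \<in> V" using merge_in_V[OF x IJ(1-3)] z'_eq by simp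
    have z'lab: "edge_label n s x z' = (int n, int (Max J), 0)"
      and z'eq: "least_atom n s z' = least_atom n s y"
      using edge_label_merge[OF x y le eq m] z'_eq by auto
    \<comment> \<open>Another partner of J0 would have maximum at least Max J0 by
      \<open>third\<close>, whereas I has the smaller maximum of its pair.\<close>
    have "J \<noteq> J0"
    proof
      assume "J = J0"
      then have "I \<noteq> I0" using z'(3) z'_eq by auto
      then show False using third[OF IJ(1) _ C(1,2)] C(3) \<open>J = J0\<close> IJ(4) by auto
    qed
    then have less: "Max J0 < Max J"
      using min[OF m] Max_part_inj[OF x IJ(2) IJ0(2)] by fastforce
    \<comment> \<open>The next merge after \<open>z'\<close>. J is neither I0 nor J0, since its
      maximum exceeds theirs. If I is neither of them too, the pair I0, J0 survives. Otherwise I is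
      one of them, and the other is merged with the union of I and J, which repeats the label of the
      step to \<open>z'\<close>.\<close>
    obtain K L where m': "mergeable z' y K L" and "Max L \<le> Max J"
    proof (cases "I = I0 \<or> I = J0")
      case False
      then have "I0 \<in> parts z'" "J0 \<in> parts z'"
        using IJ0 less \<open>J \<noteq> J0\<close> z'_eq by (auto simp: parts_merge)
      then have "mergeable z' y I0 J0" using m0 by (auto simp: mergeable_def)
      then show ?thesis using that less by simp
    next
      case True
      obtain D where D: "D \<in> parts y" "I0 \<subseteq> D" "J0 \<subseteq> D" using m0 by (auto simp: mergeable_def)
      have "C = D"
        using True C(2) D part_unique[OF y C(1) D(1)] Max_in_part[OF x IJ(1)] by blast
      obtain K where K: "K \<in> parts x" "K \<noteq> I" "K \<subseteq> C" "Max K \<le> Max J0"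
        using True IJ0 D \<open>C = D\<close> that by (metis order_less_imp_le order_refl)
      have "K \<noteq> J" using K(4) less by auto
      have "Max (I \<union> J) = Max J" using Max_Un_mergeable[OF x m] .
      then have "mergeable z' y K (I \<union> J)"
        using K \<open>K \<noteq> J\<close> C less unfolding z'_eq mergeable_def parts_merge by auto
      then show ?thesis using that \<open>Max (I \<union> J) = Max J\<close> by simp
    qed
    have "edge_label n s z' (merge z' K L) \<le> edge_label n s x z'"
      using edge_label_merge(1)[OF z'V y z'(2) z'eq m'] z'lab \<open>Max L \<le> Max J\<close> by simp
    then show ?thesis
      using covers_merge_mergeable[OF z'V y z'(2) m'] zlab z'lab less by auto
  qed
  have "greedy_step (edge_label n s) x y ?z"
    using z after others unfolding greedy_step_def by blast
  then show ?thesis by blast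
qed

section \<open>Intervals starting at \<open>Bot\<close>\<close>

lemma greedy_step_from_Bot:
  assumes y: "y \<in> V"
  shows "\<exists>z. greedy_step (edge_label n s) Bot y z"
proof -
  let ?a = "least_atom n s y"
  note a = least_atom[OF y]
  have aV: "?a \<in> V" using atomD(1)[OF a(1)] .
  have label: "edge_label n s Bot b = (int n - 1, int s + int (atom_rank n s b), 0)" for b
    by (simp add: edge_label_def)
  have "finite (atoms n s)"
    using finite_carrier by (simp add: atoms_def)
  then have fin: "finite {c \<in> atoms n s. P c}" for P by simp
  \<comment> \<open>Between \<open>?a\<close> and \<open>y\<close> the least atom is constantly
    \<open>?a\<close>, so labels directly above \<open>?a\<close> start with n, against n - 1 for
    the step from \<open>Bot\<close>.\<close>
  have after: "edge_label n s Bot ?a < edge_label n s ?a v" if v: "cov ?a v" "vp_le s v y" for v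
  proof -
    have "?a \<noteq> Bot" using aV by simp
    note vV = covers_in_V[OF v(1) this]
    have "least_atom n s ?a = ?a" using least_atom_atom[OF a(1)] .
    moreover from this have "least_atom n s v = ?a"
      using least_atom_sandwich[OF aV vV(2) y vV(3) v(2)] by simp
    ultimately show ?thesis using edge_label_const[OF aV, of v] label by simp
  qed
  have others: "edge_label n s Bot ?a < edge_label n s Bot b \<and>
      (\<exists>v. cov b v \<and> vp_le s v y \<and> edge_label n s b v \<le> edge_label n s Bot b)"
    if b: "cov Bot b" "vp_le s b y" "b \<noteq> ?a" for b
  proof -
    have atom: "b \<in> atoms n s" using covers_Bot_imp_atom[OF b(1)] .
    have bV: "b \<in> V" using atomD(1)[OF atom] .
    have word: "atom_word n s ?a < atom_word n s b" using a(3)[OF atom b(2,3)] .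
    \<comment> \<open>The atom \<open>b\<close> is counted in its own rank but not in that of
      \<open>?a\<close>.\<close>
    have "atom_rank n s ?a < atom_rank n s b"
      unfolding atom_rank_def
    proof (rule psubset_card_mono[OF fin])
      have "b \<in> {c \<in> atoms n s. atom_word n s c \<le> atom_word n s b}"
        "b \<notin> {c \<in> atoms n s. atom_word n s c \<le> atom_word n s ?a}"
        using atom word by auto
      moreover have "{c \<in> atoms n s. atom_word n s c \<le> atom_word n s ?a} \<subseteq>
          {c \<in> atoms n s. atom_word n s c \<le> atom_word n s b}"
        using word by (auto intro: order_trans order_less_imp_le)
      ultimately show "{c \<in> atoms n s. atom_word n s c \<le> atom_word n s ?a} \<subset>
          {c \<in> atoms n s. atom_word n s c \<le> atom_word n s b}" by blast
    qed
    then have "edge_label n s Bot ?a < edge_label n s Bot b" using label by simp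
    moreover have "least_atom n s b \<noteq> least_atom n s y" using least_atom_atom[OF atom] b(3) by simp
    then obtain k i where fc: "first_change_at b y k i" using first_change_at_exists[OF bV y] by blast
    obtain v where v: "cov b v" "vp_le s v y"
      "edge_label n s b v = (int k, int i, int (entry n s y i k))"
      using ex_unique_agreeing_cover[OF bV y b(2) fc] by blast
    \<comment> \<open>The rank counts \<open>b\<close> itself. A change above \<open>b\<close>
      happens at some k <= n - 1 and i <= s, and in the critical case k = n - 1 the bound i < s +
      rank still makes its label the smaller one.\<close>
    have "atom_rank n s b > 0"
      using atom fin unfolding atom_rank_def by (auto simp: card_gt_0_iff)
    then have "edge_label n s b v \<le> edge_label n s Bot b"
      using first_change_at_merge(1)[OF bV y b(2) fc] first_change_atD(2)[OF fc] v(3) label by auto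
    ultimately show ?thesis using v by blast
  qed
  have "greedy_step (edge_label n s) Bot y ?a"
    using covers_Bot_if_atom[OF a(1)] a(2) after others unfolding greedy_step_def by blast
  then show ?thesis by blast
qed

lemma EL_labeling_edge_label: "EL_labeling (vector_partitions n s) (vp_le s) (edge_label n s)"
proof (rule EL_labeling_if_greedy_step)
  fix x y assume xy: "x \<in> vector_partitions n s" "y \<in> vector_partitions n s" "vp_le s x y" "x \<noteq> y"
  show "\<exists>z. greedy_step (edge_label n s) x y z"
  proof (cases "x = Bot")
    case True
    then show ?thesis using greedy_step_from_Bot xy by simp
  next
    case False
    then have "x \<in> V" "y \<in> V" using xy vp_le_Bot_iff by auto
    then show ?thesis
      using greedy_step_if_least_atom_changes greedy_step_if_least_atom_constant xy(3,4) by blast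
  qed
qed

end

theorem theorem3p5:
  fixes n s :: nat
  assumes "n \<ge> 1" and "s \<ge> 1"
  shows "EL_labeling (vector_partitions n s) (vp_le s) (edge_label n s)"
  by (rule vector_partition_order.EL_labeling_edge_label)

end
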